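(* Suppose that $p$ is a polynomial of the form $p(z)=1+\alpha z^k+\text{(higher order terms)}$, with $\alpha\in\mathbb{C}\setminus\{0\}$ and $k\in\mathbb{N}=\{1,2,\dots\}$. If $p$ is a quadratic (degree $2$), then $p$ is not magic. If $p$ is a cubic (degree $3$), then $p$ is magic if and only if $$p(z)=1+az^2+bz^3,\quad\text{where } a,b\in\mathbb{C}\setminus\{0\}\text{ and } \operatorname{Re}(ba^{-3/2})=0.$$
   Context: For an entire function $f$, $M(r,f)=\max_{|z|=r}|f(z)|$ and the maximum modulus set is $\mathcal{M}(f)=\{z\in\mathbb{C}:|f(z)|=M(|z|,f)\}$. Let $f(z)=1+az^k+\text{(higher order terms)}$ be entire with $a\ne0$, $k\in\mathbb{N}$. The inner degree $\mu_f$ is the maximal $\mu\in\mathbb{N}$ such that $f(z)=\tilde f(z^\mu)$ for some entire function $\tilde f$. The set $J_f$: let $\Sigma=\{0,\dots,k-1\}$, $\omega_j=(2j\pi-\arg a)/k$ (with a fixed choice of $\arg a$), and for $r,\phi>0$ let $S_j(r,\phi)=\{z: 0<|z|\le r,\ |\arg z-\omega_j|<\phi\}$ (arguments modulo $2\pi$). For $T\subset\mathbb{C}$ let $\mathcal{M}(f|_T)=\{z\in T:|f(z)|=\max_{w\in T:|w|=|z|}|f(w)|\}$. There exist $R,\phi>0$ such that the sets $\gamma_j=\mathcal{M}(f|_{S_j(R,\phi)})$, $j\in\Sigma$, are disjoint analytic curves, each containing exactly one point of each modulus in $(0,R]$ and tangent at the origin to the ray $\arg z=\omega_j$, and such that $\mathcal{M}(f)\cap\{z:0<|z|\le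 R\}=\bigcup_{j\in J_f}\gamma_j$ for some $J_f\subset\Sigma$. The set $J_f$ does not depend on $R$ once $R$ is small enough, and $\#J_f$ is the number of curves making up $\mathcal{M}(f)$ near the origin; it is always a multiple of $\mu_f$. $f$ is called magic if $\#J_f>\mu_f$. The condition $\operatorname{Re}(ba^{-3/2})=0$ does not depend on the choice of square root of $a$. *)

theory Defs
  imports "HOL-Complex_Analysis.Complex_Analysis"
begin

definition max_modulus :: "real \<Rightarrow> (complex \<Rightarrow> complex) \<Rightarrow> real" where
  "max_modulus r f = (SUP z\<in>sphere 0 r. norm (f z))"

definition max_modulus_set :: "(complex \<Rightarrow> complex) \<Rightarrow> complex set" where
  "max_modulus_set f = {z. norm (f z) = max_modulus (norm z) f}"

(* The set of points of T at which the maximum over T \<inter> sphere 0 |z| is attained.  For general T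
   the supremum over that set need not be attained, so attainment is spelled out. *)
definition max_modulus_set_on :: "complex set \<Rightarrow> (complex \<Rightarrow> complex) \<Rightarrow> complex set" where
  "max_modulus_set_on T f =
     {z \<in> T. \<forall>w\<in>T. norm w = norm z \<longrightarrow> norm (f w) \<le> norm (f z)}"

definition inner_degree :: "(complex \<Rightarrow> complex) \<Rightarrow> nat" where
  "inner_degree f =
     (GREATEST \<mu>. \<mu> \<ge> 1 \<and> (\<exists>g. g holomorphic_on UNIV \<and> (\<forall>z. f z = g (z ^ \<mu>))))"

(* For f z = 1 + a z^k + (higher order terms) with a \<noteq> 0 and k \<ge> 1, the exponent k and the
   coefficient a are read off the Taylor series of f at 0. *)
definition first_exponent :: "(complex \<Rightarrow> complex) \<Rightarrow> nat" where
  "first_exponent f = subdegree (fps_expansion f 0 - 1)"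

definition first_coeff :: "(complex \<Rightarrow> complex) \<Rightarrow> complex" where
  "first_coeff f = fps_nth (fps_expansion f 0) (first_exponent f)"

(* The choice of arg a is the principal one; another choice permutes the indices j cyclically. *)
definition omega :: "(complex \<Rightarrow> complex) \<Rightarrow> nat \<Rightarrow> real" where
  "omega f j = (2 * real j * pi - Arg (first_coeff f)) / real (first_exponent f)"

(* is_Arg z \<theta> says that \<theta> is one of the arguments of z, so arguments are taken modulo 2 pi. *)
definition sector :: "(complex \<Rightarrow> complex) \<Rightarrow> nat \<Rightarrow> real \<Rightarrow> real \<Rightarrow> complex set" where
  "sector f j r \<phi> =
     {z. 0 < norm z \<and> norm z \<le> r \<and> (\<exists>\<theta>. is_Arg z \<theta> \<and> \<bar>\<theta> - omega f j\<bar> < \<phi>)}"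

definition gamma_curve :: "(complex \<Rightarrow> complex) \<Rightarrow> real \<Rightarrow> real \<Rightarrow> nat \<Rightarrow> complex set" where
  "gamma_curve f R \<phi> j = max_modulus_set_on (sector f j R \<phi>) f"

(* The trace of an injective regular real-analytic map on a nondegenerate interval.  A map is real
   analytic on I iff it extends holomorphically to a complex neighbourhood of I. *)
definition analytic_curve :: "complex set \<Rightarrow> bool" where
  "analytic_curve C \<longleftrightarrow>
     (\<exists>I g. is_interval (I :: real set) \<and> interior I \<noteq> {} \<and>
        g analytic_on (complex_of_real ` I) \<and> inj_on g (complex_of_real ` I) \<and>
        (\<forall>t\<in>I. deriv g (complex_of_real t) \<noteq> 0) \<and>
        C = g ` complex_of_real ` I)"

definition tangent_to_ray_at_0 :: "complex set \<Rightarrow> real \<Rightarrow> bool" where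
  "tangent_to_ray_at_0 C \<omega> \<longleftrightarrow> (sgn \<longlongrightarrow> cis \<omega>) (at 0 within C)"

definition admissible :: "(complex \<Rightarrow> complex) \<Rightarrow> real \<Rightarrow> real \<Rightarrow> bool" where
  "admissible f R \<phi> \<longleftrightarrow> R > 0 \<and> \<phi> > 0 \<and>
     disjoint_family_on (gamma_curve f R \<phi>) {..<first_exponent f} \<and>
     (\<forall>j<first_exponent f.
        analytic_curve (gamma_curve f R \<phi> j) \<and>
        (\<forall>r\<in>{0<..R}. \<exists>!z. z \<in> gamma_curve f R \<phi> j \<and> norm z = r) \<and>
        tangent_to_ray_at_0 (gamma_curve f R \<phi> j) (omega f j))"

definition is_J :: "(complex \<Rightarrow> complex) \<Rightarrow> nat set \<Rightarrow> bool" where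
  "is_J f J \<longleftrightarrow> J \<subseteq> {..<first_exponent f} \<and>
     (\<exists>R \<phi>. admissible f R \<phi> \<and>
        max_modulus_set f \<inter> {z. 0 < norm z \<and> norm z \<le> R} = (\<Union>j\<in>J. gamma_curve f R \<phi> j))"

(* By is_J_unique below, the set does not depend on the choice of R and \<phi>. *)
definition J_set :: "(complex \<Rightarrow> complex) \<Rightarrow> nat set" where
  "J_set f = (THE J. is_J f J)"

definition magic :: "(complex \<Rightarrow> complex) \<Rightarrow> bool" where
  "magic f \<longleftrightarrow> card (J_set f) > inner_degree f"

lemma gamma_curve_eventually_unique:
  assumes adm: "admissible f R \<phi>" "admissible f R' \<phi>'" and le: "\<phi>' \<le> \<phi>"
    and j: "j < first_exponent f"
  shows "\<exists>\<delta>>0. \<forall>z. norm z < \<delta> \<longrightarrow> z \<in> gamma_curve f R \<phi> j \<longleftrightarrow> z \<in> gamma_curve f R' \<phi>' j"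
proof -
  define w where "w = omega f j"
  have pos: "R > 0" "R' > 0" "\<phi> > 0" "\<phi>' > 0"
    using adm by (auto simp: admissible_def)
  define \<psi> where "\<psi> = min \<phi>' 1"
  have psi: "\<psi> > 0" "\<psi> \<le> \<phi>'" "\<psi> < pi" using pos pi_gt3 by (auto simp: \<psi>_def)
  have "isCont Arg 1" by (rule continuous_at_Arg) (auto simp: complex_nonpos_Reals_iff)
  then have "\<forall>\<^sub>F u in at 1. \<bar>Arg u\<bar> < \<psi>"
    using psi(1) by (auto simp: isCont_def tendsto_iff dist_real_def)
  then have "\<forall>\<^sub>F u in nhds 1. \<bar>Arg u\<bar> < \<psi>"
    using psi(1) by (simp add: eventually_nhds_conv_at)
  moreover have "((\<lambda>z. sgn z * cis (-w)) \<longlongrightarrow> 1) (at 0 within gamma_curve f R \<phi> j)"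
  proof -
    have "(sgn \<longlongrightarrow> cis w) (at 0 within gamma_curve f R \<phi> j)"
      using adm(1) j by (auto simp: admissible_def tangent_to_ray_at_0_def w_def)
    from tendsto_mult_right[OF this, of "cis (-w)"] show ?thesis by (simp add: cis_mult)
  qed
  ultimately have "\<forall>\<^sub>F z in at 0 within gamma_curve f R \<phi> j. \<bar>Arg (sgn z * cis (-w))\<bar> < \<psi>"
    by (rule eventually_compose_filterlim)
  then obtain d where d: "d > 0" "\<And>z. z \<in> gamma_curve f R \<phi> j \<Longrightarrow> z \<noteq> 0 \<Longrightarrow> norm z < d \<Longrightarrow>
      \<bar>Arg (sgn z * cis (-w))\<bar> < \<psi>"
    by (auto simp: eventually_at dist_norm)
  define \<delta> where "\<delta> = min d (min R R')"
  have fwd: "z \<in> gamma_curve f R' \<phi>' j" if z: "norm z < \<delta>" "z \<in> gamma_curve f R \<phi> j" for z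
  proof -
    have z0: "norm z > 0" using z by (auto simp: gamma_curve_def max_modulus_set_on_def sector_def)
    define \<theta> where "\<theta> = Arg (sgn z * cis (-w)) + w"
    have nz: "sgn z * cis (-w) \<noteq> 0" using z0 by (auto simp: sgn_zero_iff)
    have "sgn z * cis (-w) = cis (Arg (sgn z * cis (-w)))"
      using nz cis_Arg[OF nz] z0 by (simp add: sgn_mult sgn_div_norm[of "cis _"] norm_sgn)
    then have "sgn z * cis (-w) * cis w = cis \<theta>"
      by (metis \<theta>_def cis_mult)
    then have "sgn z = cis \<theta>" by (simp add: mult.assoc cis_mult)
    then have "is_Arg z \<theta>"
      using z0 by (simp add: is_Arg_def cis_conv_exp[symmetric] sgn_div_norm scaleR_conv_of_real field_simps)
    moreover have "\<bar>\<theta> - w\<bar> < \<phi>'" using d(2)[OF z(2)] z0 z(1) psi by (auto simp: \<theta>_def \<delta>_def)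
    ultimately have "z \<in> sector f j R' \<phi>'"
      using z0 z(1) by (auto simp: sector_def w_def \<delta>_def)
    moreover have "u \<in> sector f j R \<phi>" if "u \<in> sector f j R' \<phi>'" "norm u = norm z" for u
      using that z(1) le by (fastforce simp: sector_def \<delta>_def)
    ultimately show ?thesis
      using z(2) by (auto simp: gamma_curve_def max_modulus_set_on_def)
  qed
  have bwd: "z \<in> gamma_curve f R \<phi> j" if z: "norm z < \<delta>" "z \<in> gamma_curve f R' \<phi>' j" for z
  proof -
    have z0: "norm z > 0" using z by (auto simp: gamma_curve_def max_modulus_set_on_def sector_def)
    then have mem: "norm z \<in> {0<..R}" "norm z \<in> {0<..R'}" using z by (auto simp: \<delta>_def)
    obtain y where y: "y \<in> gamma_curve f R \<phi> j" "norm y = norm z"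
      using adm(1) j mem(1) unfolding admissible_def by blast
    have "y \<in> gamma_curve f R' \<phi>' j" using fwd[of y] y z by auto
    then have "y = z" using adm(2) j mem(2) z(2) y(2) unfolding admissible_def by blast
    with y show ?thesis by simp
  qed
  show ?thesis using fwd bwd d pos by (intro exI[of _ \<delta>]) (auto simp: \<delta>_def)
qed

theorem is_J_unique:
  assumes "is_J f J" "is_J f J'"
  shows "J = J'"
proof -
  have sub: "A \<subseteq> B" if A: "is_J f A" and B: "is_J f B" for A B
  proof
    fix j assume jA: "j \<in> A"
    obtain R \<phi> where 1: "admissible f R \<phi>" "A \<subseteq> {..<first_exponent f}"
      "max_modulus_set f \<inter> {z. 0 < norm z \<and> norm z \<le> R} = (\<Union>j\<in>A. gamma_curve f R \<phi> j)"
      using A by (auto simp: is_J_def)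
    obtain R' \<phi>' where 2: "admissible f R' \<phi>'" "B \<subseteq> {..<first_exponent f}"
      "max_modulus_set f \<inter> {z. 0 < norm z \<and> norm z \<le> R'} = (\<Union>j\<in>B. gamma_curve f R' \<phi>' j)"
      using B by (auto simp: is_J_def)
    have j: "j < first_exponent f" using jA 1 by auto
    have pos: "R > 0" "R' > 0" using 1 2 by (auto simp: admissible_def)
    have "\<exists>\<delta>>0. \<forall>z. norm z < \<delta> \<longrightarrow> z \<in> gamma_curve f R \<phi> j \<longleftrightarrow> z \<in> gamma_curve f R' \<phi>' j"
      using gamma_curve_eventually_unique[OF 1(1) 2(1) _ j]
        gamma_curve_eventually_unique[OF 2(1) 1(1) _ j] by (metis linear)
    then obtain \<delta> where \<delta>: "\<delta> > 0"
      "\<And>z. norm z < \<delta> \<Longrightarrow> z \<in> gamma_curve f R \<phi> j \<longleftrightarrow> z \<in> gamma_curve f R' \<phi>' j" by blast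
    define r where "r = min (\<delta> / 2) (min R R')"
    have r: "r \<in> {0<..R}" "r \<le> R'" "0 < r" "r < \<delta>" using \<delta> pos by (auto simp: r_def min_def)
    obtain z where z: "z \<in> gamma_curve f R \<phi> j" "norm z = r"
      using 1(1) j r(1) unfolding admissible_def by blast
    have z': "z \<in> gamma_curve f R' \<phi>' j" using \<delta>(2) z r by auto
    have "z \<in> max_modulus_set f" using 1(3) z jA by blast
    then have "z \<in> (\<Union>j\<in>B. gamma_curve f R' \<phi>' j)" using 2(3) z r by auto
    then obtain i where i: "i \<in> B" "z \<in> gamma_curve f R' \<phi>' i" by blast
    have "i = j"
      using 2(1,2) i z' j unfolding admissible_def disjoint_family_on_def by blast
    with i show "j \<in> B" by simp
  qed
  show ?thesis using sub assms by blast
qed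

end

theory Submission
  imports Defs
begin

text \<open>
  The argument reads off the curves of local maxima from the logarithmic derivative and then compares
  them by symmetry.

  On a circle of radius \<open>r\<close> the derivative of \<open>ln \<bar>f(r e\<^sup>i\<^sup>\<theta>)\<bar>\<close> with respect to \<open>\<theta>\<close> is
  \<open>- Im (z f'(z) / f(z))\<close>. If \<open>f(z) = 1 + a z\<^sup>k + \<dots>\<close>, then near the origin \<open>z f'(z) / f(z) = k a W(z)\<^sup>k\<close>,
  where \<open>W\<close> is a conformal coordinate with \<open>W(z) = z + \<dots>\<close>. Hence the critical points of \<open>\<bar>f\<bar>\<close> on
  circles form the preimages under \<open>W\<close> of the rays on which \<open>a w\<^sup>k\<close> is real. The rays \<open>arg w = \<omega>\<^sub>j\<close>
  give the local maxima: on an arc of opening \<open>\<plusminus> \<pi> / (3 k)\<close> around such a ray, \<open>ln \<bar>f\<bar>\<close> is strictly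
  concave in \<open>\<theta>\<close>, and outside these arcs \<open>Re (a z\<^sup>k)\<close> is at most half of \<open>\<bar>a z\<^sup>k\<bar>\<close>, too small for a
  global maximum. So the curves \<open>\<gamma>\<^sub>j\<close> are the traces of \<open>t \<mapsto> W\<^sup>-\<^sup>1(t e\<^sup>i\<^sup>\<omega>)\<close> with \<open>\<omega> = \<omega>\<^sub>j\<close>, and they have
  all the required properties (\<open>exists_admissible\<close>).

  Which of the curves belong to the maximum modulus set can then be decided by comparing the values
  of \<open>\<bar>f\<bar>\<close> on whole sectors (\<open>J_set_eqI\<close>). Polynomials of degree at most three require three
  comparisons. For \<open>k = 1\<close> there is only one curve. For \<open>1 + a z\<^sup>k\<close> a rotation permutes the sectors, so
  that all \<open>k\<close> curves occur, while the inner degree is \<open>k\<close>; neither case is magic. What remains is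
  \<open>1 + a z\<^sup>2 + b z\<^sup>3\<close> with \<open>b \<noteq> 0\<close>, of inner degree \<open>1\<close>, with two curves. After the rotation \<open>z = e\<^sup>i\<^sup>\<omega> u\<close>
  with \<open>\<omega> = \<omega>\<^sub>0\<close> it becomes \<open>1 + \<bar>a\<bar> u\<^sup>2 + B u\<^sup>3\<close>, where \<open>B\<close> is a positive multiple of \<open>b a\<^sup>-\<^sup>3\<^sup>/\<^sup>2\<close>, and
  the reflection \<open>u \<mapsto> - cnj u\<close> interchanges the two sectors. The squared moduli at \<open>u\<close> and at its
  reflection differ by \<open>4 Re B\<close> times a quantity that is positive on the right-hand sector
  (\<open>norm_sq_diff_reflected_cubic\<close>). Hence both curves occur if \<open>Re B = 0\<close>, and exactly one otherwise.
\<close>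

section \<open>Arcs, sectors and the maximum modulus set\<close>

lemma mem_sector_iff:
  "z \<in> sector f j r \<phi> \<longleftrightarrow>
     (\<exists>s t. z = of_real s * cis t \<and> 0 < s \<and> s \<le> r \<and> \<bar>t - omega f j\<bar> < \<phi>)"
proof
  assume "z \<in> sector f j r \<phi>"
  then show "\<exists>s t. z = of_real s * cis t \<and> 0 < s \<and> s \<le> r \<and> \<bar>t - omega f j\<bar> < \<phi>"
    unfolding sector_def is_Arg_def cis_conv_exp by blast
next
  assume "\<exists>s t. z = of_real s * cis t \<and> 0 < s \<and> s \<le> r \<and> \<bar>t - omega f j\<bar> < \<phi>"
  then obtain s t where "z = of_real s * cis t" "0 < s" "s \<le> r" "\<bar>t - omega f j\<bar> < \<phi>" by blast
  then show "z \<in> sector f j r \<phi>"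
    by (auto simp: sector_def is_Arg_def norm_mult cis_conv_exp[symmetric] intro!: exI[of _ t])
qed

lemma mem_sectorI:
  "0 < s \<Longrightarrow> s \<le> r \<Longrightarrow> \<bar>t - omega f j\<bar> < \<phi> \<Longrightarrow> of_real s * cis t \<in> sector f j r \<phi>"
  unfolding mem_sector_iff by blast

lemma mem_max_modulus_set_iff:
  assumes "continuous_on UNIV f"
  shows "z \<in> max_modulus_set f \<longleftrightarrow> (\<forall>w. norm w = norm z \<longrightarrow> norm (f w) \<le> norm (f z))"
proof -
  have "compact ((\<lambda>w. norm (f w)) ` sphere 0 (norm z))"
    by (intro compact_continuous_image continuous_intros continuous_on_subset[OF assms]) auto
  then have bdd: "bdd_above ((\<lambda>w. norm (f w)) ` sphere 0 (norm z))"
    by (simp add: bounded_imp_bdd_above compact_imp_bounded)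
  show ?thesis
  proof
    assume "z \<in> max_modulus_set f"
    then show "\<forall>w. norm w = norm z \<longrightarrow> norm (f w) \<le> norm (f z)"
      using cSUP_upper[OF _ bdd] by (auto simp: max_modulus_set_def max_modulus_def)
  next
    assume "\<forall>w. norm w = norm z \<longrightarrow> norm (f w) \<le> norm (f z)"
    then have "(SUP w\<in>sphere 0 (norm z). norm (f w)) = norm (f z)"
      by (intro cSup_eq_maximum) auto
    then show "z \<in> max_modulus_set f"
      by (simp add: max_modulus_set_def max_modulus_def)
  qed
qed

lemma max_modulus_set_meets_circle:
  fixes f :: "complex \<Rightarrow> complex"
  assumes "continuous_on UNIV f" "r \<ge> 0"
  obtains z where "norm z = r" "z \<in> max_modulus_set f"
proof -
  have "\<exists>z\<in>sphere 0 r. \<forall>w\<in>sphere 0 r. norm (f w) \<le> norm (f z)"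
    using assms(2) by (intro continuous_attains_sup continuous_intros
        continuous_on_subset[OF assms(1)]) auto
  then show ?thesis using that by (auto simp: mem_max_modulus_set_iff[OF assms(1)])
qed

text \<open>A critical point of a strictly concave function is its only maximum. This will be applied to
  \<open>U = ln \<bar>f\<bar>\<close> along the open arcs cut out by the sectors.\<close>

lemma strict_max_of_decreasing_derivative:
  fixes U V D :: "real \<Rightarrow> real"
  assumes U: "\<And>x. l < x \<Longrightarrow> x < u \<Longrightarrow> (U has_real_derivative V x) (at x)"
    and V: "\<And>x. l < x \<Longrightarrow> x < u \<Longrightarrow> (V has_real_derivative D x) (at x)"
    and D: "\<And>x. l < x \<Longrightarrow> x < u \<Longrightarrow> D x < 0"
    and x0: "l < x0" "x0 < u" "V x0 = 0" and y: "l < y" "y < u" "y \<noteq> x0"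
  shows "U y < U x0"
proof -
  have Vdec: "V t < V s" if "l < s" "s < t" "t < u" for s t
  proof (rule DERIV_neg_imp_decreasing[OF that(2)])
    fix x assume "s \<le> x" "x \<le> t"
    then have "l < x" "x < u" using that by auto
    then show "\<exists>y. (V has_real_derivative y) (at x) \<and> y < 0" using V D by blast
  qed
  have contU: "continuous_on {s..t} U" if "l < s" "t < u" for s t
  proof (rule DERIV_atLeastAtMost_imp_continuous_on)
    fix x assume "s \<le> x" "x \<le> t"
    then have "l < x" "x < u" using that by auto
    then show "\<exists>y. (U has_real_derivative y) (at x)" using U by blast
  qed
  show ?thesis
  proof (cases "y < x0")
    case True
    then show ?thesis
    proof (rule DERIV_pos_imp_increasing_open)
      show "\<exists>d. (U has_real_derivative d) (at x) \<and> d > 0" if "y < x" "x < x0" for x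
        using that x0 y U[of x] Vdec[of x x0] by (intro exI[of _ "V x"]) auto
    qed (use x0 y contU in blast)
  next
    case False
    then have "x0 < y" using y by auto
    then show ?thesis
    proof (rule DERIV_neg_imp_decreasing_open)
      show "\<exists>d. (U has_real_derivative d) (at x) \<and> d < 0" if "x0 < x" "x < y" for x
        using that x0 y U[of x] Vdec[of x0 x] by (intro exI[of _ "V x"]) auto
    qed (use x0 y contU in blast)
  qed
qed

lemma cis_circle_derivative:
  assumes "(G has_field_derivative D) (at (of_real r * cis t))"
  shows "((\<lambda>t. G (of_real r * cis t)) has_vector_derivative \<i> * (of_real r * cis t) * D) (at t)"
proof -
  have "((\<lambda>t. of_real r * cis t) has_vector_derivative of_real r * (\<i> * cis t)) (at t)"
    by (auto intro!: derivative_eq_intros simp: has_vector_derivative_def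
        scaleR_conv_of_real algebra_simps)
  from field_vector_diff_chain_at[OF this assms] show ?thesis
    by (simp add: o_def mult_ac)
qed

lemma Re_circle_derivative:
  assumes "(G has_field_derivative D) (at (of_real r * cis t))"
  shows "((\<lambda>t. Re (G (of_real r * cis t))) has_real_derivative - Im (of_real r * cis t * D)) (at t)"
  using has_field_derivative_Re[OF cis_circle_derivative[OF assms]]
  by (simp add: mult.assoc)

lemma Im_circle_derivative:
  assumes "(G has_field_derivative D) (at (of_real r * cis t))"
  shows "((\<lambda>t. Im (G (of_real r * cis t))) has_real_derivative Re (of_real r * cis t * D)) (at t)"
  using has_field_derivative_Im[OF cis_circle_derivative[OF assms]]
  by (simp add: mult.assoc)

section \<open>The germ at the origin\<close>

text \<open>The remainder is carried as an entire factor \<open>q\<close> so that its size near the origin and its Taylor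
  series are at hand at once.\<close>

locale unit_germ =
  fixes f q :: "complex \<Rightarrow> complex" and a :: complex and k :: nat
  assumes q_hol: "q holomorphic_on UNIV" and a_nz: "a \<noteq> 0" and k_pos: "k \<ge> 1"
    and f_eq: "\<And>z. f z = 1 + a * z ^ k + z ^ (k + 1) * q z"
begin

text \<open>Any opening in \<open>(0, \<pi> / (2 k))\<close> leaves room for concavity. The choice \<open>\<pi> / (3 k)\<close> makes
  \<open>cos (k \<tau>) > 1/2\<close> for \<open>\<bar>\<tau>\<bar> < \<pi> / (3 k)\<close>, and for \<open>k = 2\<close> it also makes \<open>cos (3 \<tau>)\<close> positive,
  which the comparison of the two curves of a cubic requires.\<close>

abbreviation \<phi>\<^sub>0 :: real where "\<phi>\<^sub>0 \<equiv> pi / (3 * real k)"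

lemma f_hol: "f holomorphic_on S"
proof -
  have "(\<lambda>z. 1 + a * z ^ k + z ^ (k + 1) * q z) holomorphic_on S"
    by (intro holomorphic_intros holomorphic_on_subset[OF q_hol]) auto
  then show ?thesis by (simp add: f_eq cong: holomorphic_cong)
qed

lemma f_cont: "continuous_on S f"
  by (intro holomorphic_on_imp_continuous_on f_hol)

lemma fps_expansion_f:
  "fps_expansion f 0 = 1 + fps_const a * fps_X ^ k + fps_X ^ (k + 1) * fps_expansion q 0"
proof (rule fps_expansion_eqI)
  have "q has_fps_expansion fps_expansion q 0"
    by (rule analytic_at_imp_has_fps_expansion_0) (use q_hol analytic_at in blast)
  then have "(\<lambda>z. 1 + a * z ^ k + z ^ (k + 1) * q z) has_fps_expansion
      1 + fps_const a * fps_X ^ k + fps_X ^ (k + 1) * fps_expansion q 0"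
    by (intro fps_expansion_intros)
  then show "f has_fps_expansion 1 + fps_const a * fps_X ^ k + fps_X ^ (k + 1) * fps_expansion q 0"
    by (simp add: f_eq[abs_def])
qed

lemma first_exponent_eq: "first_exponent f = k"
  unfolding first_exponent_def fps_expansion_f
  by (rule subdegreeI) (use a_nz in \<open>auto simp: fps_X_power_mult_nth simp del: power_Suc\<close>)

lemma first_coeff_eq: "first_coeff f = a"
  unfolding first_coeff_def first_exponent_eq fps_expansion_f
  using k_pos by (auto simp: fps_X_power_mult_nth simp del: power_Suc)

lemma omega_eq: "omega f j = (2 * real j * pi - Arg a) / real k"
  by (simp add: omega_def first_exponent_eq first_coeff_eq)

lemma a_cis_omega: "a * cis (omega f j) ^ k = of_real (norm a)"
proof -
  have "real k * omega f j = 2 * pi * real j - Arg a"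
    using k_pos by (simp add: omega_eq)
  then have "cis (omega f j) ^ k = cis (2 * pi * real j - Arg a)"
    by (simp only: Complex.DeMoivre)
  also have "\<dots> = cis (2 * pi * real j) * cis (- Arg a)"
    by (simp only: cis_mult diff_conv_add_uminus)
  also have "\<dots> = cis (- Arg a)" by (simp only: cis_multiple_2pi Ints_of_nat mult_1)
  finally have "a * cis (omega f j) ^ k = rcis (norm a) (Arg a) * cis (- Arg a)"
    by (simp add: rcis_cmod_Arg)
  then show ?thesis by (simp add: rcis_def mult.assoc cis_mult)
qed

lemma leading_term_on_ray:
  "a * (of_real s * cis t) ^ k = of_real (norm a * s ^ k) * cis (real k * (t - omega f j))"
proof -
  have "cis t = cis (omega f j) * cis (t - omega f j)" by (simp add: cis_mult)
  then have "a * (of_real s * cis t) ^ k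
      = of_real (s ^ k) * (a * cis (omega f j) ^ k) * cis (t - omega f j) ^ k"
    by (simp add: power_mult_distrib mult_ac)
  also have "\<dots> = of_real (norm a * s ^ k) * cis (real k * (t - omega f j))"
    by (simp add: a_cis_omega Complex.DeMoivre[of "t - omega f j"])
  finally show ?thesis .
qed

text \<open>Since \<open>z f'(z) = k a z\<^sup>k g(z)\<close> with \<open>g(0) = 1\<close>, the quotient \<open>h = g / f\<close> has a holomorphic \<open>k\<close>-th root
  \<open>s\<close> near the origin with \<open>s(0) = 1\<close>. Absorbing it into \<open>z\<close> turns the logarithmic derivative into a pure
  power. The positivity of \<open>Re f\<close> makes \<open>Ln \<circ> f\<close> holomorphic.\<close>

lemma log_derivative_normal_form:
  obtains \<rho> s where "\<rho> > 0" "s holomorphic_on ball 0 \<rho>" "s 0 = 1"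
    "\<And>z. z \<in> ball 0 \<rho> \<Longrightarrow> Re (f z) > 0"
    "\<And>z. z \<in> ball 0 \<rho> \<Longrightarrow> s z \<noteq> 0"
    "\<And>z. z \<in> ball 0 \<rho> \<Longrightarrow> z * deriv f z / f z = of_nat k * a * (z * s z) ^ k"
proof -
  define g where "g z = 1 + z * ((of_nat (k + 1) * q z + z * deriv q z) / (of_nat k * a))" for z
  define h where "h z = g z / f z" for z
  have qd: "(q has_field_derivative deriv q z) (at z)" for z
    using q_hol by (simp add: holomorphic_derivI)
  have q'_hol: "deriv q holomorphic_on UNIV" using q_hol by (simp add: holomorphic_deriv)
  have g_hol: "g holomorphic_on UNIV"
    unfolding g_def by (intro holomorphic_intros q_hol q'_hol) (use a_nz k_pos in auto)
  have f0: "f 0 = 1" using k_pos by (simp add: f_eq)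
  have df: "z * deriv f z = of_nat k * a * z ^ k * g z" for z
  proof -
    have "(f has_field_derivative
       (a * (of_nat k * z ^ (k - 1)) + (of_nat (k + 1) * z ^ k * q z + z ^ (k + 1) * deriv q z))) (at z)"
      unfolding f_eq[abs_def]
      by (rule derivative_eq_intros qd refl)+ (simp add: algebra_simps)
    then have "z * deriv f z = of_nat k * a * (z * z ^ (k - 1))
        + z * (of_nat (k + 1) * z ^ k * q z + z ^ (k + 1) * deriv q z)"
      by (simp only: DERIV_imp_deriv) (simp add: algebra_simps)
    also have "z * z ^ (k - 1) = z ^ k" using k_pos by (cases k) auto
    also have "of_nat k * a * z ^ k + z * (of_nat (k + 1) * z ^ k * q z + z ^ (k + 1) * deriv q z)
        = of_nat k * a * z ^ k + z ^ k * z * (of_nat (k + 1) * q z + z * deriv q z)"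
      by (simp add: algebra_simps)
    finally show ?thesis using a_nz k_pos by (simp add: g_def field_simps)
  qed
  have "isCont f 0" using f_cont[of UNIV] by (simp add: continuous_on_eq_continuous_at)
  moreover have "isCont g 0"
    using holomorphic_on_imp_continuous_on[OF g_hol] by (simp add: continuous_on_eq_continuous_at)
  ultimately have hc: "isCont h 0" unfolding h_def using f0 by (intro continuous_intros) auto
  have h0: "h 0 = 1" by (simp add: h_def g_def f0)
  have "\<forall>\<^sub>F z in nhds 0. Re (f z) > 0"
    using \<open>isCont f 0\<close> f0 unfolding isCont_def tendsto_at_iff_tendsto_nhds
    by (intro order_tendstoD(1)[of "\<lambda>z. Re (f z)" "Re (f 0)"] tendsto_Re) auto
  moreover have "\<forall>\<^sub>F z in nhds 0. Re (h z) > 0"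
    using hc h0 unfolding isCont_def tendsto_at_iff_tendsto_nhds
    by (intro order_tendstoD(1)[of "\<lambda>z. Re (h z)" "Re (h 0)"] tendsto_Re) auto
  ultimately have "\<forall>\<^sub>F z in nhds 0. Re (f z) > 0 \<and> Re (h z) > 0"
    by (rule eventually_conj)
  then obtain \<rho> where \<rho>: "\<rho> > 0" "\<And>z. z \<in> ball 0 \<rho> \<Longrightarrow> Re (f z) > 0 \<and> Re (h z) > 0"
    unfolding eventually_nhds_metric by (auto simp: dist_commute)
  have fnz: "f z \<noteq> 0" if "z \<in> ball 0 \<rho>" for z using \<rho>(2)[OF that] by auto
  have hnz: "h z \<notin> \<real>\<^sub>\<le>\<^sub>0" if "z \<in> ball 0 \<rho>" for z
    using \<rho>(2)[OF that] by (auto simp: complex_nonpos_Reals_iff)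
  define s where "s z = exp (Ln (h z) / of_nat k)" for z
  have "h holomorphic_on ball 0 \<rho>"
    unfolding h_def using fnz by (intro holomorphic_intros f_hol holomorphic_on_subset[OF g_hol]) auto
  then have "s holomorphic_on ball 0 \<rho>"
    unfolding s_def using hnz k_pos by (intro holomorphic_intros) auto
  moreover have "s z ^ k = h z" if "z \<in> ball 0 \<rho>" for z
  proof -
    have "h z \<noteq> 0" using hnz[OF that] by auto
    then show ?thesis using k_pos by (simp add: s_def flip: exp_of_nat_mult)
  qed
  then have "z * deriv f z / f z = of_nat k * a * (z * s z) ^ k" if "z \<in> ball 0 \<rho>" for z
    using that by (simp add: df h_def power_mult_distrib)
  ultimately show ?thesis
    using \<rho> h0 by (intro that[of \<rho> s]) (auto simp: s_def)
qed

text \<open>On a circle of small radius \<open>r\<close> put \<open>m = \<bar>a\<bar> r\<^sup>k\<close>. At a point with \<open>Re (a z\<^sup>k) \<le> m / 2\<close> the modulus of \<open>f\<close>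
  is at most \<open>1 + 3 m / 4 + C r\<^sup>k\<^sup>+\<^sup>1\<close>, while on the ray of direction \<open>\<omega>\<^sub>0\<close> it is at least
  \<open>1 + m - C r\<^sup>k\<^sup>+\<^sup>1\<close>. So a maximum satisfies \<open>cos (k (\<theta> - \<omega>\<^sub>0)) > 1/2\<close>, and this says that it
  lies in one of the sectors.\<close>

lemma max_modulus_set_in_sectors:
  obtains R where "R > 0"
    "\<And>z. 0 < norm z \<Longrightarrow> norm z \<le> R \<Longrightarrow> z \<in> max_modulus_set f \<Longrightarrow>
       \<exists>j<k. z \<in> sector f j (norm z) \<phi>\<^sub>0"
proof -
  have "compact (q ` cball 0 1)"
    by (intro compact_continuous_image holomorphic_on_imp_continuous_on
        holomorphic_on_subset[OF q_hol]) auto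
  then obtain C where C: "\<And>z. norm z \<le> 1 \<Longrightarrow> norm (q z) \<le> C"
    by (metis (no_types, lifting) bounded_iff compact_imp_bounded dist_0_norm imageI mem_cball)
  have C0: "C \<ge> 0" using order_trans[OF norm_ge_zero C[of 0]] by simp
  \<comment> \<open>The bound \<open>1 / \<bar>a\<bar>\<close> ensures \<open>m \<le> 1\<close>, and the last one ensures \<open>2 C r\<^sup>k\<^sup>+\<^sup>1 < m / 4\<close>.\<close>
  define R where "R = min 1 (min (1 / norm a) (norm a / (8 * (C + 1))))"
  have R: "R > 0" "R \<le> 1" "norm a * R \<le> 1" "8 * (C + 1) * R \<le> norm a"
  proof -
    have "R \<le> 1 / norm a" "R \<le> norm a / (8 * (C + 1))" by (simp_all add: R_def)
    then show "norm a * R \<le> 1" "8 * (C + 1) * R \<le> norm a"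
      using a_nz C0 by (simp_all add: field_simps)
  qed (use a_nz C0 in \<open>simp_all add: R_def\<close>)
  have "\<exists>j<k. z \<in> sector f j (norm z) \<phi>\<^sub>0"
    if z: "0 < norm z" "norm z \<le> R" "z \<in> max_modulus_set f" for z
  proof -
    define r where "r = norm z"
    define m where "m = norm a * r ^ k"
    have r: "0 < r" "r \<le> R" "r \<le> 1" using z R by (auto simp: r_def)
    have "r ^ k \<le> r ^ 1" using r k_pos by (intro power_decreasing) auto
    then have "m \<le> norm a * R"
      using r by (auto simp: m_def intro!: mult_left_mono)
    then have "m \<le> 1" using R(3) by (rule order_trans)
    moreover have "0 < m" using r(1) a_nz by (simp add: m_def)
    ultimately have m: "0 < m" "m \<le> 1" by auto
    have err: "norm (w ^ (k + 1) * q w) \<le> C * r ^ (k + 1)" if "norm w = r" for w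
      using C[of w] that r by (auto simp: norm_mult norm_power mult.commute[of C] intro!: mult_left_mono)
    have "Re (a * z ^ k) > m / 2"
    proof (rule ccontr)
      assume "\<not> Re (a * z ^ k) > m / 2"
      then have re: "Re (a * z ^ k) \<le> m / 2" by simp
      have nm: "norm (a * z ^ k) = m" by (simp add: m_def r_def norm_mult norm_power)
      have "norm (1 + a * z ^ k) \<le> 1 + 3 / 4 * m"
      proof (rule power2_le_imp_le)
        have "(norm (1 + a * z ^ k))\<^sup>2 = 1 + 2 * Re (a * z ^ k) + (norm (a * z ^ k))\<^sup>2"
          by (simp add: cmod_power2) (simp add: power2_eq_square algebra_simps)
        also have "\<dots> \<le> 1 + m + m * m" using re nm by (simp add: power2_eq_square)
        also have "\<dots> \<le> (1 + 3 / 4 * m)\<^sup>2"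
        proof -
          have "m * m \<le> 1 * m" using m by (intro mult_right_mono) auto
          moreover have "(1 + 3 / 4 * m)\<^sup>2 = 1 + 3 / 2 * m + 9 / 16 * (m * m)"
            by (simp add: power2_eq_square algebra_simps)
          ultimately show ?thesis using m by linarith
        qed
        finally show "(norm (1 + a * z ^ k))\<^sup>2 \<le> (1 + 3 / 4 * m)\<^sup>2" .
      qed (use m in auto)
      then have up: "norm (f z) \<le> 1 + 3 / 4 * m + C * r ^ (k + 1)"
        using norm_triangle_ineq[of "1 + a * z ^ k" "z ^ (k + 1) * q z"] err[of z]
        by (simp add: f_eq r_def)
      define w where "w = of_real r * cis (omega f 0)"
      have nw: "norm w = r" using r by (simp add: w_def norm_mult)
      have "1 + a * w ^ k = of_real (1 + m)"
        unfolding w_def leading_term_on_ray[of _ _ 0] by (simp add: m_def)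
      then have "norm (1 + a * w ^ k) = 1 + m"
        using m by (metis abs_of_pos add_pos_pos norm_of_real zero_less_one)
      then have low: "norm (f w) \<ge> 1 + m - C * r ^ (k + 1)"
        using norm_diff_ineq[of "1 + a * w ^ k" "w ^ (k + 1) * q w"] err[of w] nw
        by (simp add: f_eq)
      have "norm (f w) \<le> norm (f z)"
        using z(3) nw by (simp add: mem_max_modulus_set_iff[OF f_cont] r_def)
      with up low have "m \<le> 8 * C * r * r ^ k" by simp
      then have "norm a \<le> 8 * C * r" using r by (simp add: m_def)
      also have "\<dots> < 8 * (C + 1) * r" using r by simp
      also have "\<dots> \<le> 8 * (C + 1) * R" using r C0 by (intro mult_left_mono) auto
      also have "\<dots> \<le> norm a" by (rule R)
      finally show False by simp
    qed
    moreover define x where "x = real k * (Arg z - omega f 0)"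
    have zr: "z = of_real r * cis (Arg z)"
      using rcis_cmod_Arg[of z] by (simp add: rcis_def r_def)
    have "a * z ^ k = of_real m * cis x"
      unfolding m_def x_def by (subst zr) (rule leading_term_on_ray)
    ultimately have "Re (of_real m * cis x) > m / 2" by (simp only:)
    then have cosx: "cos x > 1 / 2" using m by simp
    \<comment> \<open>Removing \<open>n\<close> full turns from \<open>x\<close> leaves \<open>y \<in> [-\<pi>, \<pi>]\<close>; the index of the sector is \<open>n\<close> modulo \<open>k\<close>.\<close>
    define n where "n = round (x / (2 * pi))"
    define y where "y = x - 2 * pi * of_int n"
    have "\<bar>of_int n - x / (2 * pi)\<bar> \<le> 1 / 2" unfolding n_def by (rule of_int_round_abs_le)
    then have "\<bar>(of_int n - x / (2 * pi)) * (2 * pi)\<bar> \<le> 1 / 2 * (2 * pi)"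
      unfolding abs_mult by (intro mult_mono) auto
    then have ypi: "\<bar>y\<bar> \<le> pi" by (simp add: y_def algebra_simps)
    have cosy: "cos \<bar>y\<bar> > 1 / 2"
      using cosx cos_int_2pin[of n] sin_int_2pin[of n] by (simp add: y_def cos_diff)
    have y: "\<bar>y\<bar> < pi / 3"
    proof (rule ccontr)
      assume "\<not> \<bar>y\<bar> < pi / 3"
      then have "cos \<bar>y\<bar> \<le> cos (pi / 3)" using ypi by (intro cos_monotone_0_pi_le) auto
      with cosy show False by (simp add: cos_60)
    qed
    define j where "j = nat (n mod int k)"
    define l where "l = n div int k"
    have j: "j < k" using k_pos by (simp add: j_def nat_less_iff)
    have "n = int j + int k * l" using k_pos by (simp add: j_def l_def)
    then have n: "(of_int n :: real) = real j + real k * of_int l" by simp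
    define t where "t = Arg z + (2 * pi) * of_int (- l)"
    have "z = of_real r * cis t"
      using zr unfolding t_def cis_mult[symmetric] by (subst cis_multiple_2pi) auto
    moreover have "t - omega f j = y / real k"
      using k_pos by (simp add: t_def y_def x_def n omega_eq field_simps)
    then have "\<bar>t - omega f j\<bar> = \<bar>y\<bar> / real k" by (simp only: abs_divide abs_of_nat)
    then have "\<bar>t - omega f j\<bar> < \<phi>\<^sub>0"
      using divide_strict_right_mono[OF y, of "real k"] k_pos by simp
    ultimately have "z \<in> sector f j (norm z) \<phi>\<^sub>0"
      using r(1) unfolding mem_sector_iff r_def by blast
    with j show ?thesis by blast
  qed
  with R(1) show ?thesis by (rule that)
qed

end

section \<open>The curves of local maxima\<close>

text \<open>The disc and the root \<open>s\<close> of a normal form are fixed here, so that the following lemmas share one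
  coordinate \<open>W\<close> and may shrink its domain independently.\<close>

locale unit_germ_chart = unit_germ +
  fixes \<rho> :: real and s :: "complex \<Rightarrow> complex"
  assumes \<rho>_pos: "\<rho> > 0" and s_hol: "s holomorphic_on ball 0 \<rho>" and s_0: "s 0 = 1"
    and Re_f_pos: "\<And>z. z \<in> ball 0 \<rho> \<Longrightarrow> Re (f z) > 0"
    and s_nz: "\<And>z. z \<in> ball 0 \<rho> \<Longrightarrow> s z \<noteq> 0"
    and log_deriv: "\<And>z. z \<in> ball 0 \<rho> \<Longrightarrow> z * deriv f z / f z = of_nat k * a * (z * s z) ^ k"
begin

definition W :: "complex \<Rightarrow> complex" where "W z = z * s z"

lemma W_has_derivative:
  assumes "z \<in> ball 0 \<rho>"
  shows "(W has_field_derivative s z + z * deriv s z) (at z)"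
proof -
  have "(s has_field_derivative deriv s z) (at z)"
    using assms s_hol by (auto intro: holomorphic_derivI)
  then show ?thesis
    unfolding W_def[abs_def] by (auto intro!: derivative_eq_intros)
qed

lemma W_hol: "W holomorphic_on ball 0 \<rho>"
  unfolding W_def[abs_def] by (intro holomorphic_intros s_hol)

lemma s_isCont: "isCont s 0"
  using holomorphic_on_imp_continuous_on[OF s_hol] \<rho>_pos by (simp add: continuous_on_eq_continuous_at)

text \<open>With \<open>U(\<theta>) = ln \<bar>f(r e\<^sup>i\<^sup>\<theta>)\<bar>\<close> and \<open>F(z) = k a W(z)\<^sup>k\<close> we have \<open>U' = - Im F\<close> and \<open>U'' = - Re (z F'(z))\<close>, where
  \<open>z F'(z) = k\<^sup>2 a z\<^sup>k g(z)\<close> with \<open>g(0) = 1\<close>. In a sector \<open>a z\<^sup>k\<close> is a positive multiple of \<open>e\<^sup>i\<^sup>y\<close> with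
  \<open>\<bar>y\<bar> < \<pi> / 3\<close>, so \<open>U''\<close> is negative as soon as \<open>\<bar>g - 1\<bar> < 1/2\<close>.\<close>

lemma arc_strict_maximum:
  obtains \<delta> where "0 < \<delta>" "\<delta> \<le> \<rho>"
    "\<And>j r z z'. z \<in> sector f j r \<phi>\<^sub>0 \<Longrightarrow> z' \<in> sector f j r \<phi>\<^sub>0 \<Longrightarrow> norm z' = norm z \<Longrightarrow>
       norm z < \<delta> \<Longrightarrow> Im (a * W z ^ k) = 0 \<Longrightarrow> z' \<noteq> z \<Longrightarrow> norm (f z') < norm (f z)"
proof -
  define g where "g z = s z ^ (k - 1) * (s z + z * deriv s z)" for z
  have "deriv s holomorphic_on ball 0 \<rho>" using s_hol by (simp add: holomorphic_deriv)
  then have "g holomorphic_on ball 0 \<rho>"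
    unfolding g_def[abs_def] by (intro holomorphic_intros s_hol) auto
  then have "isCont g 0"
    using \<rho>_pos continuous_on_interior holomorphic_on_imp_continuous_on
    by (metis centre_in_ball interior_open open_ball)
  moreover have "g 0 = 1" by (simp add: g_def s_0)
  ultimately obtain d where d: "d > 0" "\<And>z. norm z < d \<Longrightarrow> norm (g z - 1) < 1 / 2"
    unfolding continuous_at_eps_delta
    by (metis (no_types, lifting) diff_zero dist_norm half_gt_zero_iff zero_less_one)
  define \<delta> where "\<delta> = min d \<rho>"
  have "norm (f z') < norm (f z)"
    if z: "z \<in> sector f j r \<phi>\<^sub>0" and z': "z' \<in> sector f j r \<phi>\<^sub>0" and eq: "norm z' = norm z"
      and small: "norm z < \<delta>" and Im0: "Im (a * W z ^ k) = 0" and ne: "z' \<noteq> z" for j r z z'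
  proof -
    define n where "n = norm z"
    define \<omega> where "\<omega> = omega f j"
    obtain t where t: "z = of_real n * cis t" "\<bar>t - \<omega>\<bar> < \<phi>\<^sub>0" and n: "n > 0"
      using z unfolding mem_sector_iff n_def \<omega>_def by (auto simp: norm_mult)
    obtain t' where t': "z' = of_real n * cis t'" "\<bar>t' - \<omega>\<bar> < \<phi>\<^sub>0"
      using z' eq unfolding mem_sector_iff n_def \<omega>_def by (auto simp: norm_mult)
    define c where "c x = of_real n * cis x" for x
    have c_ball: "c x \<in> ball 0 \<rho>" "norm (c x) < d" for x
      using small n by (auto simp: c_def n_def \<delta>_def norm_mult)
    define U where "U x = Re (Ln (f (c x)))" for x
    define V where "V x = - Im (of_nat k * a * W (c x) ^ k)" for x
    define D where "D x = - Re (of_nat k ^ 2 * (a * c x ^ k) * g (c x))" for x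
    have fpos: "f (c x) \<notin> \<real>\<^sub>\<le>\<^sub>0" for x
      using Re_f_pos[OF c_ball(1)[of x]] by (auto simp: complex_nonpos_Reals_iff)
    have dU: "(U has_real_derivative V x) (at x)" for x
    proof -
      have "(f has_field_derivative deriv f (c x)) (at (c x))"
        using f_hol[of UNIV] by (simp add: holomorphic_derivI)
      then have "((\<lambda>z. Ln (f z)) has_field_derivative deriv f (c x) / f (c x)) (at (c x))"
        using fpos by (auto intro!: derivative_eq_intros simp: field_simps)
      from Re_circle_derivative[OF this[unfolded c_def]] show ?thesis
        using log_deriv[OF c_ball(1)[of x]]
        unfolding U_def[abs_def] V_def c_def W_def by simp
    qed
    have dV: "(V has_real_derivative D x) (at x)" for x
    proof -
      define G where "G z = - of_nat k * a * W z ^ k" for z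
      have "(G has_field_derivative
          - of_nat k * a * (of_nat k * W (c x) ^ (k - 1) * (s (c x) + c x * deriv s (c x)))) (at (c x))"
        unfolding G_def[abs_def] using c_ball
        by (auto intro!: derivative_eq_intros W_has_derivative)
      from Im_circle_derivative[OF this[unfolded c_def], folded c_def]
      have "((\<lambda>t. Im (G (c t))) has_real_derivative Re (c x *
          (- of_nat k * a * (of_nat k * W (c x) ^ (k - 1) * (s (c x) + c x * deriv s (c x)))))) (at x)" .
      moreover have "c x * c x ^ (k - 1) = c x ^ k" using k_pos by (cases k) auto
      then have "c x * (- of_nat k * a * (of_nat k * W (c x) ^ (k - 1) * (s (c x) + c x * deriv s (c x))))
          = - (of_nat k ^ 2 * (a * c x ^ k) * g (c x))"
        by (simp add: g_def W_def power_mult_distrib power2_eq_square mult_ac flip: \<open>c x * c x ^ (k - 1) = c x ^ k\<close>)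
      ultimately show ?thesis
        by (simp only: D_def V_def[abs_def] G_def uminus_complex.sel mult_minus_left)
    qed
    have Dneg: "D x < 0" if "\<bar>x - \<omega>\<bar> < \<phi>\<^sub>0" for x
    proof -
      define y where "y = real k * (x - \<omega>)"
      have "\<bar>y\<bar> < pi / 3" using that k_pos by (simp add: y_def abs_mult mult.commute pos_less_divide_eq mult.left_commute)
      then have "cos \<bar>y\<bar> > cos (pi / 3)" by (intro cos_monotone_0_pi) auto
      then have "cos y > 1 / 2" by (simp add: cos_60)
      moreover have "\<bar>Re (cis y * (g (c x) - 1))\<bar> < 1 / 2"
        using abs_Re_le_cmod[of "cis y * (g (c x) - 1)"] d(2)[OF c_ball(2)[of x]]
        by (simp add: norm_mult)
      moreover have "cis y * g (c x) = cis y + cis y * (g (c x) - 1)" by (simp add: algebra_simps)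
      then have "Re (cis y * g (c x)) = cos y + Re (cis y * (g (c x) - 1))"
        by (simp only: plus_complex.sel cis.sel)
      ultimately have pos: "Re (cis y * g (c x)) > 0" by linarith
      have "of_nat k ^ 2 * (a * c x ^ k) * g (c x)
          = of_real (real k ^ 2 * (norm a * n ^ k)) * (cis y * g (c x))"
        unfolding c_def leading_term_on_ray[of n x j] by (simp add: y_def \<omega>_def mult_ac)
      also have "Re \<dots> = real k ^ 2 * (norm a * n ^ k) * Re (cis y * g (c x))"
        by (simp only: times_complex.sel Re_complex_of_real Im_complex_of_real mult_zero_left diff_zero)
      finally have "D x = - (real k ^ 2 * (norm a * n ^ k) * Re (cis y * g (c x)))"
        by (simp only: D_def)
      then show ?thesis using pos n k_pos a_nz by simp
    qed
    have "U t' < U t"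
    proof (rule strict_max_of_decreasing_derivative[of "\<omega> - \<phi>\<^sub>0" "\<omega> + \<phi>\<^sub>0" U V D])
      show "V t = 0" using Im0 by (simp add: V_def c_def t(1)[symmetric] mult.assoc)
      show "t' \<noteq> t" using ne t t' by auto
    qed (use dU dV Dneg t t' in \<open>auto simp: abs_less_iff\<close>)
    moreover have "f z \<noteq> 0" "f z' \<noteq> 0"
      using fpos[of t] fpos[of t'] t(1) t'(1) by (auto simp: c_def)
    ultimately show ?thesis by (simp add: U_def c_def flip: t(1) t'(1))
  qed
  moreover have "0 < \<delta>" "\<delta> \<le> \<rho>" using d \<rho>_pos by (auto simp: \<delta>_def)
  ultimately show ?thesis by (intro that[of \<delta>])
qed

text \<open>The inverse \<open>\<psi>\<close> of the coordinate \<open>W\<close>. Since \<open>\<psi>(w) = w / s(\<psi>(w))\<close> and \<open>s(0) = 1\<close>, the map \<open>\<psi>\<close> turns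
  directions by less than any prescribed angle and shrinks moduli by at most a factor of two, if \<open>w\<close> is
  small.\<close>

lemma inverse_chart:
  assumes "\<delta> > 0" "\<phi> > 0"
  obtains \<epsilon> \<psi> where "\<epsilon> > 0" "\<psi> holomorphic_on ball 0 \<epsilon>"
    "\<And>w. w \<in> ball 0 \<epsilon> \<Longrightarrow> W (\<psi> w) = w"
    "\<And>w. w \<in> ball 0 \<epsilon> \<Longrightarrow> deriv \<psi> w \<noteq> 0"
    "\<And>w. w \<in> ball 0 \<epsilon> \<Longrightarrow> norm (\<psi> w) < \<delta> \<and> norm w \<le> 2 * norm (\<psi> w)"
    "\<And>w. w \<in> ball 0 \<epsilon> \<Longrightarrow> w \<noteq> 0 \<Longrightarrow> \<exists>m>0. \<exists>\<tau>. \<psi> w = w * (of_real m * cis \<tau>) \<and> \<bar>\<tau>\<bar> < \<phi>"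
proof -
  have "isCont (\<lambda>z. inverse (s z)) 0" using s_isCont s_0 by (intro continuous_intros) auto
  moreover have "isCont Arg (inverse (s 0))"
    by (rule continuous_at_Arg) (simp add: s_0 complex_nonpos_Reals_iff)
  ultimately have "isCont (\<lambda>z. Arg (inverse (s z))) 0" by (rule isCont_o2)
  then have "isCont (\<lambda>z. \<bar>Arg (inverse (s z))\<bar>) 0" by (rule continuous_rabs)
  then have "((\<lambda>z. \<bar>Arg (inverse (s z))\<bar>) \<longlongrightarrow> \<bar>Arg (inverse (s 0))\<bar>) (nhds 0)"
    using tendsto_at_iff_tendsto_nhds[of "\<lambda>z. \<bar>Arg (inverse (s z))\<bar>" 0] by (simp add: isCont_def)
  then have "\<forall>\<^sub>F z in nhds 0. \<bar>Arg (inverse (s z))\<bar> < \<phi>"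
    by (rule order_tendstoD) (use assms s_0 in auto)
  moreover have "((\<lambda>z. norm (s z)) \<longlongrightarrow> norm (s 0)) (nhds 0)"
    using s_isCont unfolding isCont_def tendsto_at_iff_tendsto_nhds by (intro tendsto_intros)
  then have "\<forall>\<^sub>F z in nhds 0. norm (s z) < 2"
    by (rule order_tendstoD) (use s_0 in auto)
  ultimately have "\<forall>\<^sub>F z in nhds 0. \<bar>Arg (inverse (s z))\<bar> < \<phi> \<and> norm (s z) < 2"
    by (rule eventually_conj)
  then obtain d where d: "d > 0" "\<And>z. norm z < d \<Longrightarrow> \<bar>Arg (inverse (s z))\<bar> < \<phi> \<and> norm (s z) < 2"
    unfolding eventually_nhds_metric by auto
  define S where "S = ball (0 :: complex) (min \<rho> (min d \<delta>))"
  have S: "open S" "0 \<in> S" "S \<subseteq> ball 0 \<rho>" using d assms \<rho>_pos by (auto simp: S_def)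
  have "W holomorphic_on S" using W_hol S(3) by (rule holomorphic_on_subset)
  moreover have "deriv W 0 \<noteq> 0" using DERIV_imp_deriv[OF W_has_derivative[of 0]] \<rho>_pos s_0 by simp
  ultimately obtain r where r: "r > 0" "ball 0 r \<subseteq> S" "open (W ` ball 0 r)" "inj_on W (ball 0 r)"
    using has_complex_derivative_locally_invertible[of W S 0] S by metis
  have Wr: "W holomorphic_on ball 0 r" using W_hol S(3) r(2) by (meson holomorphic_on_subset)
  obtain \<psi> where \<psi>: "\<psi> holomorphic_on W ` ball 0 r"
    "\<And>z. z \<in> ball 0 r \<Longrightarrow> deriv W z * deriv \<psi> (W z) = 1"
    "\<And>z. z \<in> ball 0 r \<Longrightarrow> \<psi> (W z) = z"
    using holomorphic_has_inverse[OF Wr _ r(4)] by auto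
  have "0 \<in> W ` ball 0 r" using r(1) by (auto simp: W_def image_iff intro!: bexI[of _ 0])
  then obtain \<epsilon> where \<epsilon>: "\<epsilon> > 0" "ball 0 \<epsilon> \<subseteq> W ` ball 0 r"
    using r(3) by (meson openE)
  have *: "\<exists>z\<in>ball 0 r. w = W z \<and> \<psi> w = z" if "w \<in> ball 0 \<epsilon>" for w
    using that \<epsilon>(2) \<psi>(3) by force
  show ?thesis
  proof (rule that[of \<epsilon> \<psi>])
    show "\<psi> holomorphic_on ball 0 \<epsilon>" using \<psi>(1) \<epsilon>(2) by (rule holomorphic_on_subset)
    fix w :: complex assume w: "w \<in> ball 0 \<epsilon>"
    then obtain z where z: "z \<in> ball 0 r" "w = W z" "\<psi> w = z" using * by blast
    have zS: "norm z < d" "norm z < \<delta>" "z \<in> ball 0 \<rho>" using z(1) r(2) by (auto simp: S_def)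
    show "W (\<psi> w) = w" using z by simp
    show "deriv \<psi> w \<noteq> 0" using \<psi>(2)[OF z(1)] z(2) by auto
    have "norm w \<le> 2 * norm z"
      using d(2)[OF zS(1)] by (simp add: z(2) W_def norm_mult mult.commute[of 2] mult_left_mono)
    then show "norm (\<psi> w) < \<delta> \<and> norm w \<le> 2 * norm (\<psi> w)" using zS z by simp
    have "z = w * inverse (s z)" using s_nz[OF zS(3)] by (simp add: z(2) W_def)
    also have "inverse (s z) = of_real (norm (inverse (s z))) * cis (Arg (inverse (s z)))"
      using rcis_cmod_Arg[of "inverse (s z)"] by (simp only: rcis_def)
    finally show "\<exists>m>0. \<exists>\<tau>. \<psi> w = w * (of_real m * cis \<tau>) \<and> \<bar>\<tau>\<bar> < \<phi>"
      using d(2)[OF zS(1)] s_nz[OF zS(3)] z(3)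
      by (intro exI[of _ "norm (inverse (s z))"] conjI exI[of _ "Arg (inverse (s z))"]) auto
  qed (rule \<epsilon>)
qed

text \<open>The curves are \<open>c\<^sub>j(t) = \<psi>(t e\<^sup>i\<^sup>\<omega>)\<close> with \<open>\<omega> = \<omega>\<^sub>j\<close>. Each of their points is the strict maximum of \<open>\<bar>f\<bar>\<close>
  on its arc. Two points of the same curve and the same modulus would each be larger than the other, so
  \<open>\<bar>c\<^sub>j\<bar>\<close> is injective; by the intermediate value theorem it is increasing and takes every small value.
  Therefore \<open>\<gamma>\<^sub>j\<close> is the trace of \<open>c\<^sub>j\<close> on an interval \<open>(0, T]\<close>.\<close>

lemma exists_admissible_in_chart:
  obtains R where "admissible f R \<phi>\<^sub>0"
    "max_modulus_set f \<inter> {z. 0 < norm z \<and> norm z \<le> R} \<subseteq> (\<Union>j<k. gamma_curve f R \<phi>\<^sub>0 j)"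
proof -
  have phi_pos: "\<phi>\<^sub>0 > 0" using k_pos by simp
  obtain \<delta> where \<delta>: "0 < \<delta>" "\<delta> \<le> \<rho>"
    and strict: "\<And>j r z z'. z \<in> sector f j r \<phi>\<^sub>0 \<Longrightarrow> z' \<in> sector f j r \<phi>\<^sub>0 \<Longrightarrow> norm z' = norm z \<Longrightarrow>
       norm z < \<delta> \<Longrightarrow> Im (a * W z ^ k) = 0 \<Longrightarrow> z' \<noteq> z \<Longrightarrow> norm (f z') < norm (f z)"
    using arc_strict_maximum by blast
  obtain \<epsilon> \<psi> where \<epsilon>: "\<epsilon> > 0" and \<psi>_hol: "\<psi> holomorphic_on ball 0 \<epsilon>"
    and W_\<psi>: "\<And>w. w \<in> ball 0 \<epsilon> \<Longrightarrow> W (\<psi> w) = w"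
    and \<psi>': "\<And>w. w \<in> ball 0 \<epsilon> \<Longrightarrow> deriv \<psi> w \<noteq> 0"
    and \<psi>_norm: "\<And>w. w \<in> ball 0 \<epsilon> \<Longrightarrow> norm (\<psi> w) < \<delta> \<and> norm w \<le> 2 * norm (\<psi> w)"
    and \<psi>_arg: "\<And>w. w \<in> ball 0 \<epsilon> \<Longrightarrow> w \<noteq> 0 \<Longrightarrow>
        \<exists>m>0. \<exists>\<tau>. \<psi> w = w * (of_real m * cis \<tau>) \<and> \<bar>\<tau>\<bar> < \<phi>\<^sub>0"
    using inverse_chart[OF \<delta>(1) phi_pos] by blast
  obtain R1 where R1: "R1 > 0"
    "\<And>z. 0 < norm z \<Longrightarrow> norm z \<le> R1 \<Longrightarrow> z \<in> max_modulus_set f \<Longrightarrow>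
       \<exists>j<k. z \<in> sector f j (norm z) \<phi>\<^sub>0"
    using max_modulus_set_in_sectors by blast
  define R where "R = min (\<epsilon> / 4) R1"
  have R: "R > 0" "R \<le> \<epsilon> / 4" "R \<le> R1" using \<epsilon> R1 by (auto simp: R_def)
  define c where "c j t = \<psi> (of_real t * cis (omega f j))" for j t
  have ray_ball: "of_real t * cis (omega f j) \<in> ball 0 \<epsilon>" if "0 \<le> t" "t < \<epsilon>" for t j
    using that by (simp add: norm_mult)
  have W_c: "W (c j t) = of_real t * cis (omega f j)" if "0 \<le> t" "t < \<epsilon>" for t j
    using W_\<psi>[OF ray_ball[OF that]] by (simp add: c_def)
  have c_norm: "norm (c j t) < \<delta>" "t \<le> 2 * norm (c j t)" if "0 \<le> t" "t < \<epsilon>" for t j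
    using \<psi>_norm[OF ray_ball[OF that, of j]] that by (auto simp: c_def norm_mult)
  have c_0: "c j 0 = 0" for j
  proof -
    have "c j 0 \<in> ball 0 \<rho>" using c_norm(1)[of 0 j] \<epsilon> \<delta> by simp
    then show ?thesis using W_c[of 0 j] \<epsilon> s_nz by (auto simp: W_def)
  qed
  have c_cont: "continuous_on {0..u} (\<lambda>t. norm (c j t))" if "u < \<epsilon>" for u j
    unfolding c_def
    by (intro continuous_intros continuous_on_compose2[OF holomorphic_on_imp_continuous_on[OF \<psi>_hol]])
      (use that ray_ball in force)
  have c_sector: "c j t \<in> sector f j r \<phi>\<^sub>0" if t: "0 < t" "t < \<epsilon>" and r: "norm (c j t) \<le> r" for j t r
  proof -
    obtain m \<tau> where m: "m > 0" "c j t = of_real t * cis (omega f j) * (of_real m * cis \<tau>)" "\<bar>\<tau>\<bar> < \<phi>\<^sub>0"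
      using \<psi>_arg[OF ray_ball[of t j]] t unfolding c_def by auto
    have c_eq: "c j t = of_real (t * m) * cis (omega f j + \<tau>)"
      by (simp add: m(2) cis_mult[symmetric] mult_ac)
    then have "norm (c j t) = t * m" using t m by (simp add: norm_mult)
    then have "t * m \<le> r" using r by (simp only:)
    then show ?thesis unfolding c_eq using t(1) m(1,3) by (intro mem_sectorI) simp_all
  qed
  have c_max: "norm (f z) < norm (f (c j t))"
    if t: "0 < t" "t < \<epsilon>" and z: "z \<in> sector f j r \<phi>\<^sub>0" "norm z = norm (c j t)" "z \<noteq> c j t" for j t r z
  proof (rule strict[OF _ z(1,2)])
    have "norm z \<le> r" using z(1) by (simp add: sector_def)
    then show "c j t \<in> sector f j r \<phi>\<^sub>0" using c_sector t z(2) by simp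
    have "a * W (c j t) ^ k = of_real (norm a * t ^ k)"
      using t by (simp add: W_c leading_term_on_ray[of _ _ j])
    then show "Im (a * W (c j t) ^ k) = 0" by (simp only: Im_complex_of_real)
  qed (use t z c_norm in auto)
  have c_inj: "t = t'" if t: "0 < t" "t < \<epsilon>" "0 < t'" "t' < \<epsilon>"
    and eq: "c i t = c j t'" for i j t t'
  proof -
    have "norm (W (c i t)) = norm (W (c j t'))" using eq by simp
    then show ?thesis using t by (simp add: W_c norm_mult)
  qed
  have c_norm_inj: "t = t'" if t: "0 < t" "t < \<epsilon>" "0 < t'" "t' < \<epsilon>"
    and eq: "norm (c j t) = norm (c j t')" for j t t'
  proof (rule ccontr)
    assume "t \<noteq> t'"
    then have "c j t \<noteq> c j t'" using c_inj t by blast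
    then show False
      using c_max[OF t(1,2) c_sector[OF t(3,4) order_refl], of j] c_max[OF t(3,4) c_sector[OF t(1,2) order_refl], of j] eq
      by fastforce
  qed
  have c_norm_hits: "\<exists>t. 0 < t \<and> t \<le> u \<and> norm (c j t) = r"
    if u: "0 < r" "r \<le> norm (c j u)" "0 \<le> u" "u < \<epsilon>" for j u r
  proof -
    obtain t where "0 \<le> t" "t \<le> u" "norm (c j t) = r"
      using IVT'[of "\<lambda>t. norm (c j t)" 0 r u] u c_0 c_cont[of u j] by auto
    moreover from this have "t \<noteq> 0" using c_0 u by auto
    ultimately show ?thesis by (intro exI[of _ t]) auto
  qed
  have c_norm_mono: "norm (c j t) < norm (c j t')" if t: "0 < t" "t < t'" "t' < \<epsilon>" for j t t'
  proof (rule ccontr)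
    assume "\<not> norm (c j t) < norm (c j t')"
    moreover have "0 < norm (c j t')" using c_norm(2)[of t' j] t by linarith
    ultimately obtain x where "0 < x" "x \<le> t" "norm (c j x) = norm (c j t')"
      using c_norm_hits[of "norm (c j t')" j t] t by auto
    with c_norm_inj[of x t' j] t show False by auto
  qed
  have c_gamma: "c j t \<in> gamma_curve f R \<phi>\<^sub>0 j" if t: "0 < t" "t < \<epsilon>" "norm (c j t) \<le> R" for j t
    unfolding gamma_curve_def max_modulus_set_on_def
    using c_sector[OF t] c_max[OF t(1,2)] by (force intro: less_imp_le)
  have hits: "\<exists>t. 0 < t \<and> t \<le> \<epsilon> / 2 \<and> norm (c j t) = r" if "0 < r" "r \<le> R" for r j
    using c_norm_hits[of r j "\<epsilon> / 2"] c_norm(2)[of "\<epsilon> / 2" j] that R \<epsilon> by simp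
  have gammaD: "\<exists>t. 0 < t \<and> t \<le> \<epsilon> / 2 \<and> z = c j t \<and> norm z \<le> R"
    if z: "z \<in> gamma_curve f R \<phi>\<^sub>0 j" for z j
  proof -
    have zs: "z \<in> sector f j R \<phi>\<^sub>0" using z by (simp add: gamma_curve_def max_modulus_set_on_def)
    then have zn: "0 < norm z" "norm z \<le> R" by (auto simp: sector_def)
    then obtain t where t: "0 < t" "t \<le> \<epsilon> / 2" "norm (c j t) = norm z" using hits by metis
    then have "c j t \<in> sector f j R \<phi>\<^sub>0" using c_sector zn \<epsilon> by simp
    then have "norm (f (c j t)) \<le> norm (f z)"
      using z t by (simp add: gamma_curve_def max_modulus_set_on_def)
    then have "z = c j t" using c_max[of t z j R] zs t \<epsilon> by fastforce
    with t zn show ?thesis by blast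
  qed
  have adm: "admissible f R \<phi>\<^sub>0"
    unfolding admissible_def first_exponent_eq
  proof (intro conjI allI impI ballI)
    show "disjoint_family_on (gamma_curve f R \<phi>\<^sub>0) {..<k}"
    proof (unfold disjoint_family_on_def, intro ballI impI equals0I)
      fix i j z assume ij: "i \<in> {..<k}" "j \<in> {..<k}" "i \<noteq> j"
        and "z \<in> gamma_curve f R \<phi>\<^sub>0 i \<inter> gamma_curve f R \<phi>\<^sub>0 j"
      then obtain t t' where t: "0 < t" "t \<le> \<epsilon> / 2" "z = c i t" and t': "0 < t'" "t' \<le> \<epsilon> / 2" "z = c j t'"
        using gammaD by blast
      then have "t = t'" using c_inj[of t t' i j] \<epsilon> by auto
      moreover have "W (c i t) = W (c j t')" using t t' by simp
      ultimately have "cis (omega f i) = cis (omega f j)" using t t' \<epsilon> by (simp add: W_c)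
      moreover have "cis (omega f n) = cis (2 * pi * real n / real k) * cis (- Arg a / real k)" for n
        by (simp add: cis_mult omega_eq diff_divide_distrib mult_ac)
      ultimately have "cis (2 * pi * real i / real k) = cis (2 * pi * real j / real k)" by simp
      moreover have "inj_on (\<lambda>n. cis (2 * pi * real n / real k)) {..<k}"
        using Complex.bij_betw_roots_unity[of k] k_pos by (auto simp: bij_betw_def)
      ultimately show False using ij by (auto dest: inj_onD)
    qed
  next
    fix j assume "j < k"
    obtain T where T: "0 < T" "T \<le> \<epsilon> / 2" "norm (c j T) = R" using hits[of R j] R by auto
    have gamma: "gamma_curve f R \<phi>\<^sub>0 j = c j ` {0<..T}"
    proof (intro equalityI subsetI)
      fix z assume "z \<in> gamma_curve f R \<phi>\<^sub>0 j"
      then obtain t where t: "0 < t" "t \<le> \<epsilon> / 2" "z = c j t" "norm z \<le> R" using gammaD by blast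
      have "t \<le> T" using c_norm_mono[of T t j] T t \<epsilon> by force
      with t show "z \<in> c j ` {0<..T}" by auto
    next
      fix z assume "z \<in> c j ` {0<..T}"
      then obtain t where t: "0 < t" "t \<le> T" "z = c j t" by auto
      then have "norm (c j t) \<le> R" using c_norm_mono[of t T j] T \<epsilon> by (cases "t = T") auto
      with t T \<epsilon> c_gamma show "z \<in> gamma_curve f R \<phi>\<^sub>0 j" by auto
    qed
    show "analytic_curve (gamma_curve f R \<phi>\<^sub>0 j)"
      unfolding analytic_curve_def
    proof (intro exI conjI ballI)
      define g where "g w = \<psi> (w * cis (omega f j))" for w
      have mem: "w * cis (omega f j) \<in> ball 0 \<epsilon>" if "w \<in> ball 0 \<epsilon>" for w
        using that by (simp add: norm_mult)
      have "g holomorphic_on ball 0 \<epsilon>"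
        unfolding g_def using mem
        by (intro holomorphic_on_compose_gen[OF _ \<psi>_hol, unfolded o_def] holomorphic_intros) auto
      then have "g analytic_on ball 0 \<epsilon>" by (simp add: analytic_on_open)
      moreover have "complex_of_real ` {0<..T} \<subseteq> ball 0 \<epsilon>" using T \<epsilon> by auto
      ultimately show "g analytic_on complex_of_real ` {0<..T}" by (rule analytic_on_subset)
      show "is_interval {0<..T}" by (rule is_interval_oc)
      show "interior {0<..T} \<noteq> {}" using T by simp
      show "inj_on g (complex_of_real ` {0<..T})"
      proof (intro inj_onI, elim imageE)
        fix x y t t' assume "g x = g y" "x = of_real t" "y = of_real t'" "t \<in> {0<..T}" "t' \<in> {0<..T}"
        then have "t = t'" using c_inj[of t t' j j] T \<epsilon> by (auto simp: g_def c_def)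
        then show "x = y" using \<open>x = of_real t\<close> \<open>y = of_real t'\<close> by simp
      qed
      show "deriv g (complex_of_real t) \<noteq> 0" if "t \<in> {0<..T}" for t
      proof -
        have t: "of_real t \<in> ball (0 :: complex) \<epsilon>" using that T \<epsilon> by auto
        then have "(\<psi> has_field_derivative deriv \<psi> (of_real t * cis (omega f j))) (at (of_real t * cis (omega f j)))"
          using \<psi>_hol mem by (intro holomorphic_derivI) auto
        then have "(g has_field_derivative deriv \<psi> (of_real t * cis (omega f j)) * cis (omega f j)) (at (of_real t))"
          unfolding g_def by (rule DERIV_chain2) (auto intro!: derivative_eq_intros)
        then have "deriv g (of_real t) = deriv \<psi> (of_real t * cis (omega f j)) * cis (omega f j)"
          by (rule DERIV_imp_deriv)
        then show ?thesis using \<psi>'[OF mem[OF t]] by simp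
      qed
      show "gamma_curve f R \<phi>\<^sub>0 j = g ` complex_of_real ` {0<..T}"
        unfolding gamma by (simp add: g_def c_def image_image)
    qed
    show "\<exists>!z. z \<in> gamma_curve f R \<phi>\<^sub>0 j \<and> norm z = r" if r: "r \<in> {0<..R}" for r
    proof -
      obtain t where t: "0 < t" "t \<le> \<epsilon> / 2" "norm (c j t) = r" using hits[of r j] r by auto
      show ?thesis
      proof (rule ex1I[of _ "c j t"])
        show "c j t \<in> gamma_curve f R \<phi>\<^sub>0 j \<and> norm (c j t) = r" using c_gamma t r \<epsilon> by auto
        fix z assume z: "z \<in> gamma_curve f R \<phi>\<^sub>0 j \<and> norm z = r"
        then obtain t' where t': "0 < t'" "t' \<le> \<epsilon> / 2" "z = c j t'" using gammaD by blast
        then show "z = c j t" using c_norm_inj[of t t' j] t z \<epsilon> by auto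
      qed
    qed
    \<comment> \<open>On the curve \<open>z s(z) = t e\<^sup>i\<^sup>\<omega>\<close>, so the direction of \<open>z\<close> differs from \<open>\<omega>\<close> by that of \<open>s(z) \<rightarrow> 1\<close>.\<close>
    show "tangent_to_ray_at_0 (gamma_curve f R \<phi>\<^sub>0 j) (omega f j)"
      unfolding tangent_to_ray_at_0_def
    proof (rule Lim_transform_eventually)
      have "(s \<longlongrightarrow> 1) (at 0 within gamma_curve f R \<phi>\<^sub>0 j)"
        using s_isCont s_0 by (auto simp: isCont_def intro: tendsto_within_subset)
      then have "((\<lambda>z. cis (omega f j) * inverse (sgn (s z))) \<longlongrightarrow> cis (omega f j) * inverse (sgn 1))
          (at 0 within gamma_curve f R \<phi>\<^sub>0 j)"
        by (intro tendsto_intros) auto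
      then show "((\<lambda>z. cis (omega f j) * inverse (sgn (s z))) \<longlongrightarrow> cis (omega f j))
          (at 0 within gamma_curve f R \<phi>\<^sub>0 j)" by simp
      have "cis (omega f j) * inverse (sgn (s z)) = sgn z" if z: "z \<in> gamma_curve f R \<phi>\<^sub>0 j" for z
      proof -
        obtain t where t: "0 < t" "t \<le> \<epsilon> / 2" "z = c j t" using gammaD z by blast
        have "z \<in> ball 0 \<rho>" using c_norm(1)[of t j] t \<delta> \<epsilon> by auto
        then have "sgn (s z) \<noteq> 0" using s_nz by (simp add: sgn_zero_iff)
        moreover have "sgn (z * s z) = cis (omega f j)"
          using W_c[of t j] t \<epsilon> unfolding W_def by (simp add: sgn_mult sgn_of_real)
        ultimately show ?thesis by (simp add: sgn_mult field_simps)
      qed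
      then show "\<forall>\<^sub>F z in at 0 within gamma_curve f R \<phi>\<^sub>0 j. cis (omega f j) * inverse (sgn (s z)) = sgn z"
        by (auto simp: eventually_at_filter)
    qed
  qed (use R phi_pos in auto)
  have "z \<in> (\<Union>j<k. gamma_curve f R \<phi>\<^sub>0 j)"
    if z: "z \<in> max_modulus_set f" "0 < norm z" "norm z \<le> R" for z
  proof -
    obtain j where "j < k" "z \<in> sector f j (norm z) \<phi>\<^sub>0" using R1(2) z R by force
    then have "z \<in> gamma_curve f R \<phi>\<^sub>0 j"
      using z unfolding gamma_curve_def max_modulus_set_on_def mem_max_modulus_set_iff[OF f_cont]
      by (auto simp: sector_def)
    with \<open>j < k\<close> show ?thesis by blast
  qed
  with adm show ?thesis by (intro that[of R]) auto
qed

end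

context unit_germ
begin

lemma exists_admissible:
  obtains R where "admissible f R \<phi>\<^sub>0"
    "max_modulus_set f \<inter> {z. 0 < norm z \<and> norm z \<le> R} \<subseteq> (\<Union>j<k. gamma_curve f R \<phi>\<^sub>0 j)"
proof -
  obtain \<rho> s where "\<rho> > 0" "s holomorphic_on ball 0 \<rho>" "s 0 = 1"
    "\<And>z. z \<in> ball 0 \<rho> \<Longrightarrow> Re (f z) > 0" "\<And>z. z \<in> ball 0 \<rho> \<Longrightarrow> s z \<noteq> 0"
    "\<And>z. z \<in> ball 0 \<rho> \<Longrightarrow> z * deriv f z / f z = of_nat k * a * (z * s z) ^ k"
    using log_derivative_normal_form by blast
  then have "unit_germ_chart f q a k \<rho> s" by unfold_locales
  then interpret unit_germ_chart f q a k \<rho> s .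
  show ?thesis using exists_admissible_in_chart that by blast
qed

section \<open>Comparing the curves\<close>

text \<open>Each \<open>\<gamma>\<^sub>j\<close> collects the maxima over sector \<open>j\<close>, so it is enough to compare sectors circle by circle:
  the curves in the maximum modulus set are those of the sectors in which the largest values occur.\<close>

lemma J_set_eqI:
  assumes J: "J \<subseteq> {..<k}"
    and weak: "\<And>i j r z. j \<in> J \<Longrightarrow> i < k \<Longrightarrow> z \<in> sector f i r \<phi>\<^sub>0 \<Longrightarrow>
        \<exists>z'\<in>sector f j r \<phi>\<^sub>0. norm z' = norm z \<and> norm (f z) \<le> norm (f z')"
    and strict: "\<And>i r z. i < k \<Longrightarrow> i \<notin> J \<Longrightarrow> z \<in> sector f i r \<phi>\<^sub>0 \<Longrightarrow>
        \<exists>z'. norm z' = norm z \<and> norm (f z) < norm (f z')"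
  shows "J_set f = J"
proof -
  obtain R where R: "admissible f R \<phi>\<^sub>0"
    "max_modulus_set f \<inter> {z. 0 < norm z \<and> norm z \<le> R} \<subseteq> (\<Union>j<k. gamma_curve f R \<phi>\<^sub>0 j)"
    using exists_admissible by blast
  note max_iff = mem_max_modulus_set_iff[OF f_cont]
  have gamma_sub: "gamma_curve f R \<phi>\<^sub>0 j \<subseteq> sector f j R \<phi>\<^sub>0" for j
    by (auto simp: gamma_curve_def max_modulus_set_on_def)
  have "max_modulus_set f \<inter> {z. 0 < norm z \<and> norm z \<le> R} = (\<Union>j\<in>J. gamma_curve f R \<phi>\<^sub>0 j)"
  proof (intro equalityI subsetI)
    fix z assume z: "z \<in> max_modulus_set f \<inter> {z. 0 < norm z \<and> norm z \<le> R}"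
    then obtain i where i: "i < k" "z \<in> gamma_curve f R \<phi>\<^sub>0 i" using R(2) by blast
    have "i \<in> J"
    proof (rule ccontr)
      assume "i \<notin> J"
      then obtain z' where "norm z' = norm z" "norm (f z) < norm (f z')"
        using strict i gamma_sub by blast
      then show False using z by (auto simp: max_iff not_le[symmetric])
    qed
    with i show "z \<in> (\<Union>j\<in>J. gamma_curve f R \<phi>\<^sub>0 j)" by blast
  next
    fix z assume "z \<in> (\<Union>j\<in>J. gamma_curve f R \<phi>\<^sub>0 j)"
    then obtain j where j: "j \<in> J" "z \<in> gamma_curve f R \<phi>\<^sub>0 j" by blast
    then have zn: "0 < norm z" "norm z \<le> R" using gamma_sub[of j] by (auto simp: sector_def)
    obtain y where y: "norm y = norm z" "y \<in> max_modulus_set f"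
      using max_modulus_set_meets_circle[OF f_cont, of "norm z"] by auto
    then have "y \<in> (\<Union>j<k. gamma_curve f R \<phi>\<^sub>0 j)" using R(2) zn by auto
    then obtain i where "i < k" "y \<in> sector f i R \<phi>\<^sub>0" using gamma_sub by blast
    then obtain z' where z': "z' \<in> sector f j R \<phi>\<^sub>0" "norm z' = norm y" "norm (f y) \<le> norm (f z')"
      using weak j(1) by blast
    then have "norm (f z') \<le> norm (f z)"
      using j(2) y(1) by (simp add: gamma_curve_def max_modulus_set_on_def)
    with z'(3) y have "norm (f w) \<le> norm (f z)" if "norm w = norm z" for w
      using that by (force simp: max_iff)
    then show "z \<in> max_modulus_set f \<inter> {z. 0 < norm z \<and> norm z \<le> R}"
      using zn by (simp add: max_iff)
  qed
  then have is_J: "is_J f J" using J R(1) unfolding is_J_def first_exponent_eq by blast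
  show ?thesis unfolding J_set_def
    by (rule the_equality) (rule is_J, rule is_J_unique[OF _ is_J])
qed

lemma J_set_singleton_if_k_eq_1:
  assumes "k = 1"
  shows "J_set f = {0}"
proof (rule J_set_eqI)
  fix i j r z assume "j \<in> {0 :: nat}" "i < k" "z \<in> sector f i r \<phi>\<^sub>0"
  then show "\<exists>z'\<in>sector f j r \<phi>\<^sub>0. norm z' = norm z \<and> norm (f z) \<le> norm (f z')"
    using assms by (intro bexI[of _ z]) auto
qed (use assms in auto)

text \<open>The rotation by \<open>\<omega>\<^sub>j - \<omega>\<^sub>i\<close> preserves \<open>1 + a z\<^sup>k\<close> and carries sector \<open>i\<close> to sector \<open>j\<close>.\<close>

lemma J_set_full_if_monomial:
  assumes "\<And>z. q z = 0"
  shows "J_set f = {..<k}"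
proof (rule J_set_eqI)
  fix i j r z assume "z \<in> sector f i r \<phi>\<^sub>0"
  then obtain s t where t: "z = of_real s * cis t" "0 < s" "s \<le> r" "\<bar>t - omega f i\<bar> < \<phi>\<^sub>0"
    unfolding mem_sector_iff by blast
  define z' where "z' = of_real s * cis (t - omega f i + omega f j)"
  have "z' \<in> sector f j r \<phi>\<^sub>0"
    unfolding z'_def using t by (intro mem_sectorI) auto
  moreover have "norm z' = norm z" using t by (simp add: z'_def norm_mult)
  moreover have "f z' = f z"
    using leading_term_on_ray[of s t i] leading_term_on_ray[of s "t - omega f i + omega f j" j]
    by (simp add: f_eq assms z'_def t(1))
  ultimately show "\<exists>z'\<in>sector f j r \<phi>\<^sub>0. norm z' = norm z \<and> norm (f z) \<le> norm (f z')"
    by (intro bexI[of _ z']) auto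
qed auto

end

section \<open>Cubics without linear term\<close>

text \<open>Up to conjugation, the value at the reflected point \<open>- cnj u\<close> is \<open>1 + A u\<^sup>2 - cnj B u\<^sup>3\<close>. The two values
  differ by \<open>2 Re B u\<^sup>3\<close>, and the terms in \<open>\<bar>B\<bar>\<^sup>2\<close> cancel, so \<open>Re B\<close> is a factor of the difference of the
  squared moduli.\<close>

lemma norm_sq_diff_reflected_cubic:
  fixes u B :: complex and A :: real
  shows "(norm (1 + of_real A * u ^ 2 + B * u ^ 3))\<^sup>2
      - (norm (1 + of_real A * (- cnj u) ^ 2 + B * (- cnj u) ^ 3))\<^sup>2
    = 4 * Re B * (Re (u ^ 3) + A * norm u ^ 4 * Re u)"
proof -
  have 4: "norm u ^ 4 = ((Re u)\<^sup>2 + (Im u)\<^sup>2)\<^sup>2"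
    by (simp add: cmod_power2[symmetric])
  show ?thesis
    unfolding 4 by (simp add: cmod_power2) (simp add: power2_eq_square power3_eq_cube algebra_simps)
qed

locale cubic_germ = unit_germ f "\<lambda>_. b" a 2 for f :: "complex \<Rightarrow> complex" and a b :: complex
begin

text \<open>The cubic coefficient after the rotation that carries the ray of direction \<open>\<omega>\<^sub>0\<close> to the positive
  axis.\<close>

definition B :: complex where "B = b * cis (omega f 0) ^ 3"

text \<open>With the principal logarithm, \<open>a\<^sup>-\<^sup>3\<^sup>/\<^sup>2\<close> has the argument \<open>- 3 Arg a / 2 = 3 \<omega>\<^sub>0\<close>.\<close>

lemma Re_B: "Re (b * a powr (-3/2)) = exp (- 3 / 2 * ln (norm a)) * Re B"
proof -
  have "a powr (-3/2) = exp (of_real (- 3 / 2 * ln (norm a)) + \<i> * of_real (3 * omega f 0))"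
    using a_nz by (simp add: powr_def Ln_Arg omega_eq algebra_simps)
  also have "\<dots> = exp (of_real (- 3 / 2 * ln (norm a))) * exp (\<i> * of_real (3 * omega f 0))"
    by (rule exp_add)
  also have "\<dots> = of_real (exp (- 3 / 2 * ln (norm a))) * cis (omega f 0) ^ 3"
    by (simp only: exp_of_real Complex.DeMoivre of_nat_numeral flip: cis_conv_exp)
  finally have "b * a powr (-3/2) = of_real (exp (- 3 / 2 * ln (norm a))) * B"
    by (simp add: B_def mult_ac)
  then show ?thesis by simp
qed

text \<open>For \<open>u = s e\<^sup>i\<^sup>t\<close> with \<open>\<bar>t\<bar> < \<pi> / 6\<close> both \<open>Re (u\<^sup>3)\<close> and \<open>Re u\<close> are positive.\<close>

lemma norm_sq_diff_reflected:
  assumes s: "0 < s" and t: "\<bar>t\<bar> < \<phi>\<^sub>0"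
  obtains c where "c > 0"
    "(norm (f (of_real s * cis (omega f 0 + t))))\<^sup>2
      - (norm (f (of_real s * cis (omega f 1 - t))))\<^sup>2 = c * Re B"
proof
  define u where "u = of_real s * cis t"
  define \<zeta> where "\<zeta> = cis (omega f 0)"
  have f: "f (\<zeta> * v) = 1 + of_real (norm a) * v ^ 2 + B * v ^ 3" for v
    using a_cis_omega[of 0]
    by (simp add: f_eq B_def power_mult_distrib mult_ac flip: \<zeta>_def)
  have u: "of_real s * cis (omega f 0 + t) = \<zeta> * u"
    by (simp add: u_def \<zeta>_def cis_mult[symmetric] mult_ac)
  have "cis (omega f 1 - t) = \<zeta> * - cis (- t)"
  proof -
    have "cis (omega f 1 - t) = cis (omega f 0 + pi + - t)" by (simp add: omega_eq field_simps)
    also have "\<dots> = \<zeta> * cis pi * cis (- t)" by (simp only: cis_mult \<zeta>_def)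
    finally show ?thesis by simp
  qed
  then have u': "of_real s * cis (omega f 1 - t) = \<zeta> * - cnj u"
    by (simp add: u_def cis_cnj)
  have "cos (3 * t) > 0" "cos t > 0" using t by (intro cos_gt_zero_pi; simp add: abs_less_iff)+
  then show "4 * (Re (u ^ 3) + norm a * norm u ^ 4 * Re u) > 0"
    using s a_nz by (simp add: u_def power_mult_distrib Complex.DeMoivre norm_mult add_pos_pos flip: of_real_power)
  show "(norm (f (of_real s * cis (omega f 0 + t))))\<^sup>2
      - (norm (f (of_real s * cis (omega f 1 - t))))\<^sup>2
      = 4 * (Re (u ^ 3) + norm a * norm u ^ 4 * Re u) * Re B"
    unfolding u u' f norm_sq_diff_reflected_cubic by simp
qed

lemma reflect_sector_0:
  assumes "z \<in> sector f 0 r \<phi>\<^sub>0"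
  obtains z' c where "z' \<in> sector f 1 r \<phi>\<^sub>0" "norm z' = norm z" "c > 0"
    "(norm (f z))\<^sup>2 - (norm (f z'))\<^sup>2 = c * Re B"
proof -
  obtain s t where t: "z = of_real s * cis t" "0 < s" "s \<le> r" "\<bar>t - omega f 0\<bar> < \<phi>\<^sub>0"
    using assms unfolding mem_sector_iff by blast
  define t' where "t' = omega f 1 - (t - omega f 0)"
  obtain c where "c > 0"
    "(norm (f z))\<^sup>2 - (norm (f (of_real s * cis t')))\<^sup>2 = c * Re B"
    using norm_sq_diff_reflected[OF t(2,4)] by (auto simp: t(1) t'_def)
  moreover have "of_real s * cis t' \<in> sector f 1 r \<phi>\<^sub>0"
    using t by (intro mem_sectorI) (auto simp: t'_def abs_minus_commute)
  moreover have "norm (of_real s * cis t') = norm z" by (simp add: t(1) norm_mult)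
  ultimately show ?thesis using that by blast
qed

lemma reflect_sector_1:
  assumes "z \<in> sector f 1 r \<phi>\<^sub>0"
  obtains z' c where "z' \<in> sector f 0 r \<phi>\<^sub>0" "norm z' = norm z" "c > 0"
    "(norm (f z'))\<^sup>2 - (norm (f z))\<^sup>2 = c * Re B"
proof -
  obtain s t where t: "z = of_real s * cis t" "0 < s" "s \<le> r" "\<bar>t - omega f 1\<bar> < \<phi>\<^sub>0"
    using assms unfolding mem_sector_iff by blast
  define t' where "t' = omega f 0 + (omega f 1 - t)"
  have t4: "\<bar>omega f 1 - t\<bar> < \<phi>\<^sub>0" using t(4) by (simp add: abs_minus_commute)
  obtain c where "c > 0"
    "(norm (f (of_real s * cis t')))\<^sup>2 - (norm (f z))\<^sup>2 = c * Re B"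
    using norm_sq_diff_reflected[OF t(2) t4] by (auto simp: t(1) t'_def)
  moreover have "of_real s * cis t' \<in> sector f 0 r \<phi>\<^sub>0"
    using t by (intro mem_sectorI) (auto simp: t'_def abs_minus_commute)
  moreover have "norm (of_real s * cis t') = norm z" by (simp add: t(1) norm_mult)
  ultimately show ?thesis using that by blast
qed

text \<open>The reflection exchanges the two sectors, and the sign of \<open>Re B\<close> says which of them has the larger
  values.\<close>

lemma card_J_set: "card (J_set f) = (if Re B = 0 then 2 else 1)"
proof -
  have le: "\<exists>z'\<in>sector f j r \<phi>\<^sub>0. norm z' = norm z \<and> norm (f z) \<le> norm (f z')"
    if ij: "i < 2" "j < 2" and z: "z \<in> sector f i r \<phi>\<^sub>0"
      and B: "i = 0 \<Longrightarrow> j = 1 \<Longrightarrow> Re B \<le> 0" "i = 1 \<Longrightarrow> j = 0 \<Longrightarrow> Re B \<ge> 0" for i j r z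
  proof -
    consider "i = j" | "i = 0" "j = 1" | "i = 1" "j = 0" using ij by linarith
    then show ?thesis
    proof cases
      case 1
      then show ?thesis using z by auto
    next
      case 2
      then obtain z' c where z': "z' \<in> sector f 1 r \<phi>\<^sub>0" "norm z' = norm z" "c > 0"
        "(norm (f z))\<^sup>2 - (norm (f z'))\<^sup>2 = c * Re B"
        using reflect_sector_0 z by blast
      have "c * Re B \<le> 0" using z'(3) B(1)[OF 2] by (simp add: mult_nonneg_nonpos)
      then have "(norm (f z))\<^sup>2 \<le> (norm (f z'))\<^sup>2" using z'(4) by linarith
      then have "norm (f z) \<le> norm (f z')" by (rule power2_le_imp_le) simp
      then show ?thesis using 2 z' by blast
    next
      case 3
      then obtain z' c where z': "z' \<in> sector f 0 r \<phi>\<^sub>0" "norm z' = norm z" "c > 0"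
        "(norm (f z'))\<^sup>2 - (norm (f z))\<^sup>2 = c * Re B"
        using reflect_sector_1 z by blast
      have "c * Re B \<ge> 0" using z'(3) B(2)[OF 3] by simp
      then have "(norm (f z))\<^sup>2 \<le> (norm (f z'))\<^sup>2" using z'(4) by linarith
      then have "norm (f z) \<le> norm (f z')" by (rule power2_le_imp_le) simp
      then show ?thesis using 3 z' by blast
    qed
  qed
  consider "Re B = 0" | "Re B > 0" | "Re B < 0" by linarith
  then show ?thesis
  proof cases
    case 1
    have "J_set f = {..<2}" by (rule J_set_eqI) (use le 1 in auto)
    then show ?thesis using 1 by simp
  next
    case 2
    have "J_set f = {0}"
    proof (rule J_set_eqI)
      fix i r z assume "i < (2 :: nat)" "i \<notin> {0}" and z: "z \<in> sector f i r \<phi>\<^sub>0"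
      then have "i = 1" by simp
      with z obtain z' c where z': "norm z' = norm z" "c > 0"
        "(norm (f z'))\<^sup>2 - (norm (f z))\<^sup>2 = c * Re B"
        using reflect_sector_1 by blast
      have "c * Re B > 0" using z'(2) 2 by simp
      then have "(norm (f z))\<^sup>2 < (norm (f z'))\<^sup>2" using z'(3) by linarith
      then have "norm (f z) < norm (f z')" by (rule power2_less_imp_less) simp
      then show "\<exists>z'. norm z' = norm z \<and> norm (f z) < norm (f z')" using z' by blast
    qed (use le 2 in auto)
    then show ?thesis using 2 by simp
  next
    case 3
    have "J_set f = {1}"
    proof (rule J_set_eqI)
      fix i r z assume "i < (2 :: nat)" "i \<notin> {1}" and z: "z \<in> sector f i r \<phi>\<^sub>0"
      then have "i = 0" by simp
      with z obtain z' c where z': "norm z' = norm z" "c > 0"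
        "(norm (f z))\<^sup>2 - (norm (f z'))\<^sup>2 = c * Re B"
        using reflect_sector_0 by blast
      have "c * Re B < 0" using z'(2) 3 by (simp add: mult_pos_neg)
      then have "(norm (f z))\<^sup>2 < (norm (f z'))\<^sup>2" using z'(3) by linarith
      then have "norm (f z) < norm (f z')" by (rule power2_less_imp_less) simp
      then show "\<exists>z'. norm z' = norm z \<and> norm (f z) < norm (f z')" using z' by blast
    qed (use le 3 in auto)
    then show ?thesis using 3 by simp
  qed
qed

end

section \<open>The inner degree of a polynomial\<close>

text \<open>A polynomial in \<open>z\<^sup>\<mu>\<close> is invariant under multiplication of \<open>z\<close> by a primitive \<open>\<mu>\<close>-th root of unity; the
  \<open>n\<close>-th coefficient is multiplied by the \<open>n\<close>-th power of that root.\<close>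

lemma dvd_exponent_of_inner_power:
  assumes "\<mu> \<ge> 1" "\<And>z. poly p z = g (z ^ \<mu>)" "coeff p n \<noteq> (0 :: complex)"
  shows "\<mu> dvd n"
proof -
  define \<zeta> where "\<zeta> = exp (2 * of_real pi * \<i> * of_nat 1 / of_nat \<mu>)"
  have \<zeta>: "\<zeta> ^ \<mu> = 1" unfolding \<zeta>_def using assms(1) by (intro complex_root_unity) auto
  have "poly (pcompose p [:0, \<zeta>:]) z = poly p z" for z
    by (simp add: poly_pcompose assms(2) power_mult_distrib \<zeta> mult.commute)
  then have "pcompose p [:0, \<zeta>:] = p" by (intro poly_ext)
  then have "\<zeta> ^ n * coeff p n = coeff p n" by (metis coeff_pcompose_linear)
  then have "\<zeta> ^ n = 1" using assms(3) by simp
  then have "exp (2 * of_real pi * \<i> * of_nat n / of_nat \<mu>) = exp (2 * of_real pi * \<i> * of_nat 0 / of_nat \<mu>)"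
    by (simp add: \<zeta>_def mult_ac flip: exp_of_nat_mult)
  then have "n mod \<mu> = 0 mod \<mu>"
    using complex_root_unity_eq[of \<mu> n 0] assms(1) by simp
  then show ?thesis by auto
qed

text \<open>A nonzero coefficient of positive index bounds the candidates, so that the greatest one exists.\<close>

lemma inner_degree_poly:
  assumes "n \<ge> 1" "coeff p n \<noteq> (0 :: complex)"
  shows inner_degree_ge_1: "inner_degree (poly p) \<ge> 1"
    and inner_degree_dvd: "inner_degree (poly p) dvd n"
    and le_inner_degree: "\<mu> \<ge> 1 \<Longrightarrow> g holomorphic_on UNIV \<Longrightarrow> (\<And>z. poly p z = g (z ^ \<mu>)) \<Longrightarrow>
      \<mu> \<le> inner_degree (poly p)"
proof -
  define P where "P \<mu> \<longleftrightarrow> \<mu> \<ge> 1 \<and> (\<exists>g. g holomorphic_on UNIV \<and> (\<forall>z. poly p z = g (z ^ \<mu>)))" for \<mu>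
  have inner: "inner_degree (poly p) = (GREATEST \<mu>. P \<mu>)"
    by (simp add: inner_degree_def P_def)
  have dvd: "\<mu> dvd n" if "P \<mu>" for \<mu>
    using that assms(2) dvd_exponent_of_inner_power[of \<mu> p] unfolding P_def by metis
  then have bound: "\<mu> \<le> n" if "P \<mu>" for \<mu> using that assms(1) by (intro dvd_imp_le) auto
  have "P 1" by (auto simp: P_def intro!: exI[of _ "poly p"] holomorphic_intros)
  then have G: "P (inner_degree (poly p))"
    unfolding inner using bound by (rule GreatestI_nat) auto
  then show "inner_degree (poly p) \<ge> 1" by (simp add: P_def)
  from G show "inner_degree (poly p) dvd n" by (rule dvd)
  assume "\<mu> \<ge> 1" "g holomorphic_on UNIV" "\<And>z. poly p z = g (z ^ \<mu>)"
  then have "P \<mu>" by (auto simp: P_def)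
  then show "\<mu> \<le> inner_degree (poly p)"
    unfolding inner using bound by (rule Greatest_le_nat) auto
qed

section \<open>Quadratics and cubics\<close>

theorem theorem1p7:
  fixes p q :: "complex poly" and \<alpha> :: complex and k :: nat
  assumes "\<alpha> \<noteq> 0" and "k \<ge> 1"
    and "p = 1 + monom \<alpha> k + monom 1 (k + 1) * q"
  shows "(degree p = 2 \<longrightarrow> \<not> magic (poly p)) \<and>
    (degree p = 3 \<longrightarrow>
      (magic (poly p) \<longleftrightarrow>
        (\<exists>a b. a \<noteq> 0 \<and> b \<noteq> 0 \<and> (\<forall>z. poly p z = 1 + a * z ^ 2 + b * z ^ 3) \<and>
          Re (b * a powr (-3/2)) = 0)))"
proof -
  have poly_p: "poly p z = 1 + \<alpha> * z ^ k + z ^ (k + 1) * poly q z" for z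
    by (simp add: assms(3) poly_monom)
  interpret unit_germ "poly p" "poly q" \<alpha> k
    by unfold_locales (use assms(1,2) poly_p in \<open>simp_all add: holomorphic_intros\<close>)
  have coeff_k: "coeff p k = \<alpha>"
    using assms(2) by (simp add: assms(3) coeff_monom_mult del: One_nat_def)
  have coeff_above: "coeff p (k + 1 + m) = coeff q m" for m
    using assms(2) by (simp add: assms(3) coeff_monom_mult)
  have coeff_below: "coeff p m = 0" if "0 < m" "m < k" for m
    using that by (simp add: assms(3) coeff_monom_mult)
  have k_le: "k \<le> degree p" using coeff_k assms(1) by (auto intro: le_degree)
  have ge_1: "inner_degree (poly p) \<ge> 1"
    using inner_degree_ge_1[of k p] assms(1,2) coeff_k by auto
  have k1: "\<not> magic (poly p)" if "k = 1"
    using ge_1 J_set_singleton_if_k_eq_1[OF that] by (simp add: magic_def)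
  have monomial: "\<not> magic (poly p)" if "k = degree p"
  proof -
    have "coeff q m = 0" for m using coeff_above[of m] that by (simp add: coeff_eq_0)
    then have q0: "q = 0" by (simp add: poly_eq_iff)
    then have "J_set (poly p) = {..<k}" by (intro J_set_full_if_monomial) simp
    moreover have "k \<le> inner_degree (poly p)"
    proof (rule le_inner_degree)
      show "(\<lambda>w. 1 + \<alpha> * w) holomorphic_on UNIV" by (intro holomorphic_intros)
      show "poly p z = 1 + \<alpha> * z ^ k" for z using poly_p q0 by simp
    qed (use assms coeff_k in auto)
    ultimately show ?thesis by (simp add: magic_def)
  qed
  \<comment> \<open>The existentially quantified \<open>a\<close> and \<open>b\<close> are forced to be coefficients of \<open>p\<close>; for \<open>k \<noteq> 2\<close> this
      contradicts \<open>\<alpha> \<noteq> 0\<close> or \<open>a \<noteq> 0\<close>.\<close>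
  have cubic_form: "a = coeff p 2 \<and> b = coeff p 3 \<and> coeff p 1 = 0"
    if "\<forall>z. poly p z = 1 + a * z ^ 2 + b * z ^ 3" for a b
  proof -
    have "poly p = poly [:1, 0, a, b:]"
      using that by (auto simp: power2_eq_square power3_eq_cube algebra_simps)
    then have "p = [:1, 0, a, b:]" by (simp add: poly_eq_poly_eq_iff)
    then show ?thesis by (simp add: numeral_eq_Suc)
  qed
  have "\<not> magic (poly p)" if "degree p = 2"
    using that k_le assms(2) k1 monomial by (cases "k = 1") auto
  moreover have "magic (poly p) \<longleftrightarrow>
        (\<exists>a b. a \<noteq> 0 \<and> b \<noteq> 0 \<and> (\<forall>z. poly p z = 1 + a * z ^ 2 + b * z ^ 3) \<and>
          Re (b * a powr (-3/2)) = 0)" (is "_ \<longleftrightarrow> ?R") if deg: "degree p = 3"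
  proof -
    consider "k = 1" | "k = 2" | "k = 3" using k_le deg assms(2) by linarith
    then show ?thesis
    proof cases
      case 1
      have "\<not> ?R" using cubic_form coeff_k assms(1) 1 by metis
      with k1[OF 1] show ?thesis by blast
    next
      case 3
      have "\<not> ?R" using cubic_form coeff_below[of 2] 3 by force
      with monomial 3 deg show ?thesis by simp
    next
      case 2
      define b where "b = coeff p 3"
      have "p \<noteq> 0" using deg by auto
      then have b: "b \<noteq> 0" using deg unfolding b_def by (metis leading_coeff_neq_0)
      have "coeff q m = coeff [:b:] m" for m
        using coeff_above[of m] 2 deg by (cases m) (auto simp: b_def coeff_eq_0 numeral_eq_Suc)
      then have q: "q = [:b:]" by (simp add: poly_eq_iff)
      then have form: "poly p z = 1 + \<alpha> * z ^ 2 + b * z ^ 3" for z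
        using poly_p[of z] 2 by (simp add: power3_eq_cube power2_eq_square)
      interpret cubic: cubic_germ "poly p" \<alpha> b
        using unit_germ_axioms unfolding cubic_germ_def 2 q by (simp add: unit_germ_def)
      have "inner_degree (poly p) dvd 3" "inner_degree (poly p) dvd 2"
        using inner_degree_dvd[of 3 p] inner_degree_dvd[of 2 p] b coeff_k assms(1) 2 by (auto simp: b_def)
      then have "inner_degree (poly p) dvd 3 - 2" by (rule dvd_diff_nat)
      then have "inner_degree (poly p) = 1" by simp
      then have "magic (poly p) \<longleftrightarrow> Re cubic.B = 0" by (simp add: magic_def cubic.card_J_set)
      also have "\<dots> \<longleftrightarrow> Re (b * \<alpha> powr (-3/2)) = 0" by (simp only: cubic.Re_B mult_eq_0_iff exp_not_eq_zero simp_thms)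
      also have "\<dots> \<longleftrightarrow> ?R"
      proof
        assume "Re (b * \<alpha> powr (-3/2)) = 0"
        with form b assms(1) show ?R by blast
      next
        assume ?R
        then show "Re (b * \<alpha> powr (-3/2)) = 0" using cubic_form coeff_k 2 by (metis b_def)
      qed
      finally show ?thesis .
    qed
  qed
  ultimately show ?thesis by blast
qed

end
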